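(* Let $\lambda$ be a frequency and let $p=1$ or $p=\infty$. For $N\in\mathbb{N}$ let $$\pi_p^N\colon\mathcal{H}_p(\lambda)\to\mathcal{H}_p(\lambda),\qquad \sum a_ne^{-\lambda_ns}\mapsto\sum_{n=1}^Na_ne^{-\lambda_ns}.$$ (1) If $\lambda$ satisfies $(BC)$, then there is a constant $C=C(\lambda)$ such that $\|\pi_p^N\colon\mathcal{H}_p(\lambda)\to\mathcal{H}_p(\lambda)\|\le C\lambda_N$ for all $N$. (2) If $\lambda$ satisfies $(LC)$ and $L(\lambda)<\infty$, then for every $\delta>0$ there is a constant $C_1=C_1(\delta,\lambda)$ such that $\|\pi_p^N\colon\mathcal{H}_p(\lambda)\to\mathcal{H}_p(\lambda)\|\le C_1e^{\delta\lambda_N}$ for all $N$.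
   Context: A frequency is a strictly increasing sequence $\lambda=(\lambda_n)_{n\ge1}$ of non-negative real numbers tending to $\infty$. A $\lambda$-Dirichlet series is a formal sum $D=\sum a_n e^{-\lambda_n s}$ with complex coefficients $a_n$. $L(\lambda):=\limsup_{n\to\infty}\frac{\log n}{\lambda_n}$. Bohr's condition $(BC)$: there is $l=l(\lambda)>0$ such that for every $\delta>0$ there is $C>0$ with $\lambda_{n+1}-\lambda_n\ge Ce^{-(l+\delta)\lambda_n}$ for all $n\in\mathbb{N}$. Landau's condition $(LC)$: for every $\delta>0$ there is $C>0$ with $\lambda_{n+1}-\lambda_n\ge Ce^{-e^{\delta\lambda_n}}$ for all $n\in\mathbb{N}$. A Dirichlet group is a pair $(G,\beta)$ of a compact abelian group $G$ and a continuous homomorphism $\beta\colon\mathbb{R}\to G$ with dense range. It is a $\lambda$-Dirichlet group if for every $n$ there is a (necessarily unique) character $h_{\lambda_n}\in\widehat{G}$ with $h_{\lambda_n}(\beta(t))=e^{-i\lambda_n t}$ for all $t\in\mathbb{R}$. $L_p(G)$ is taken with respect to the normalized Haar measure $m$, and $\widehat{f}(\gamma)=\int_G f\overline{\gamma}\,dm$. $H_p^\lambda(G)$ is the space of all $f\in L_p(G)$ such that $\widehat f(\gamma)\ne0$ only if $\gamma=h_{\lambda_n}$ for some $n$. $\mathcal{H}_p(\lambda)$ is the Banach space of all $\lambda$-Dirichlet series $D=\sum a_ne^{-\lambda_ns}$ for which there is $f\in H_p^\lambda(G)$ with $\widehat f(h_{\lambda_n})=a_n$ for all $n$, with norm $\|D\|_p=\|f\|_p$;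 it does not depend on the choice of the $\lambda$-Dirichlet group $(G,\beta)$.
   Formalization: Part (1) is stated for all N with λ_N > 0: if λ_1 = 0 and N = 1 (e.g. λ_n = log n) the claimed bound Cλ_1 = 0 fails, since π^1 fixes the constant series 1, which has norm 1. *)

theory Defs
  imports "HOL-Probability.Essential_Supremum" "HOL-Algebra.Group"
begin

section \<open>Frequencies\<close>

text \<open>
  Frequencies and coefficient sequences are indexed from \<open>0\<close>: \<open>lam n\<close> is the \<open>(n+1)\<close>-st
  frequency, and \<open>a n\<close> the coefficient of \<open>e\<close> to the power \<open>- lam n * s\<close>.
\<close>

definition frequency :: "(nat \<Rightarrow> real) \<Rightarrow> bool" where
  "frequency lam \<longleftrightarrow> strict_mono lam \<and> (\<forall>n. 0 \<le> lam n) \<and> filterlim lam at_top sequentially"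

definition freq_L :: "(nat \<Rightarrow> real) \<Rightarrow> ereal" where
  "freq_L lam = limsup (\<lambda>n. ereal (ln (real (Suc n)) / lam n))"

definition bohr_condition :: "(nat \<Rightarrow> real) \<Rightarrow> bool" where
  "bohr_condition lam \<longleftrightarrow>
     (\<exists>l>0. \<forall>\<delta>>0. \<exists>C>0. \<forall>n. lam (Suc n) - lam n \<ge> C * exp (- (l + \<delta>) * lam n))"

definition landau_condition :: "(nat \<Rightarrow> real) \<Rightarrow> bool" where
  "landau_condition lam \<longleftrightarrow>
     (\<forall>\<delta>>0. \<exists>C>0. \<forall>n. lam (Suc n) - lam n \<ge> C * exp (- exp (\<delta> * lam n)))"


section \<open>Dirichlet groups\<close>

locale compact_abelian_group = comm_group G for G (structure) +
  fixes T :: "'a topology"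
  assumes topspace_eq: "topspace T = carrier G"
    and compact: "compact_space T"
    and Hausdorff: "Hausdorff_space T"
    and continuous_mult: "continuous_map (prod_topology T T) T (\<lambda>(x, y). x \<otimes> y)"
    and continuous_inv: "continuous_map T T (\<lambda>x. inv x)"

locale dirichlet_group = compact_abelian_group +
  fixes \<beta> :: "real \<Rightarrow> 'a"
  assumes continuous_\<beta>: "continuous_map euclidean T \<beta>"
    and \<beta>_add: "\<And>s t. \<beta> (s + t) = \<beta> s \<otimes> \<beta> t"
    and dense_\<beta>: "Abstract_Topology.closure_of T (range \<beta>) = carrier G"

text \<open>Characters are extensional, so that distinct members differ on the group itself.\<close>

definition characters :: "('a, 'b) monoid_scheme \<Rightarrow> 'a topology \<Rightarrow> ('a \<Rightarrow> complex) set" where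
  "characters G T =
     {\<gamma> \<in> carrier G \<rightarrow>\<^sub>E sphere 0 1. continuous_map T euclidean \<gamma> \<and>
        (\<forall>x\<in>carrier G. \<forall>y\<in>carrier G. \<gamma> (x \<otimes>\<^bsub>G\<^esub> y) = \<gamma> x * \<gamma> y)}"

definition lambda_dirichlet_group ::
  "(nat \<Rightarrow> real) \<Rightarrow> ('a, 'b) monoid_scheme \<Rightarrow> 'a topology \<Rightarrow> (real \<Rightarrow> 'a) \<Rightarrow> bool" where
  "lambda_dirichlet_group lam G T \<beta> \<longleftrightarrow> dirichlet_group G T \<beta> \<and>
     (\<forall>n. \<exists>h\<in>characters G T. \<forall>t. h (\<beta> t) = exp (- \<i> * of_real (lam n * t)))"

definition freq_char ::
  "('a, 'b) monoid_scheme \<Rightarrow> 'a topology \<Rightarrow> (real \<Rightarrow> 'a) \<Rightarrow> real \<Rightarrow> 'a \<Rightarrow> complex" where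
  "freq_char G T \<beta> x =
     (THE h. h \<in> characters G T \<and> (\<forall>t. h (\<beta> t) = exp (- \<i> * of_real (x * t))))"

lemma (in dirichlet_group) character_eqI:
  assumes \<gamma>: "\<gamma> \<in> characters G T" and \<eta>: "\<eta> \<in> characters G T"
    and eq: "\<And>t. \<gamma> (\<beta> t) = \<eta> (\<beta> t)"
  shows "\<gamma> = \<eta>"
proof (rule extensionalityI[where A = "carrier G"])
  show "\<gamma> \<in> extensional (carrier G)" "\<eta> \<in> extensional (carrier G)"
    using \<gamma> \<eta> by (auto simp: characters_def PiE_def)
  fix x assume "x \<in> carrier G"
  then have "x \<in> Abstract_Topology.closure_of T (range \<beta>)"
    by (simp add: dense_\<beta>)
  moreover have "continuous_map T euclidean \<gamma>" "continuous_map T euclidean \<eta>"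
    using \<gamma> \<eta> by (auto simp: characters_def)
  ultimately show "\<gamma> x = \<eta> x"
    using forall_in_closure_of_eq[of x T "range \<beta>" euclidean \<gamma> \<eta>] eq by auto
qed

lemma freq_char:
  assumes "lambda_dirichlet_group lam G T \<beta>"
  shows "freq_char G T \<beta> (lam n) \<in> characters G T \<and>
    (\<forall>t. freq_char G T \<beta> (lam n) (\<beta> t) = exp (- \<i> * of_real (lam n * t)))"
proof -
  interpret dirichlet_group G T \<beta>
    using assms by (simp add: lambda_dirichlet_group_def)
  define P where "P h \<longleftrightarrow> h \<in> characters G T \<and>
    (\<forall>t. h (\<beta> t) = exp (- \<i> * of_real (lam n * t)))" for h
  obtain h where "P h"
    using assms by (auto simp: lambda_dirichlet_group_def P_def)
  then have "P (THE h. P h)"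
    by (rule HOL.theI[of P h]) (use \<open>P h\<close> in \<open>auto simp: P_def intro!: character_eqI\<close>)
  then show ?thesis
    by (simp add: P_def freq_char_def)
qed

text \<open>
  The Borel probability measure is required to be regular, as usual for Haar measures when the
  topology need not have a countable base. As the measure is finite, inner regularity on all
  Borel sets includes outer regularity.
\<close>

definition normalized_haar_measure ::
  "('a, 'b) monoid_scheme \<Rightarrow> 'a topology \<Rightarrow> 'a measure \<Rightarrow> bool" where
  "normalized_haar_measure G T m \<longleftrightarrow>
     space m = carrier G \<and>
     sets m = sigma_sets (carrier G) {U. openin T U} \<and>
     emeasure m (carrier G) = 1 \<and>
     (\<forall>x\<in>carrier G. \<forall>A\<in>sets m. emeasure m ((\<lambda>y. x \<otimes>\<^bsub>G\<^esub> y) ` A) = emeasure m A) \<and>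
     (\<forall>A\<in>sets m. emeasure m A = (SUP K\<in>{K. compactin T K \<and> K \<subseteq> A}. emeasure m K))"


section \<open>Lebesgue and Hardy spaces\<close>

text \<open>The exponent \<open>p\<close> ranges over \<open>[1, \<infinity>]\<close>; functions are not identified modulo null sets.\<close>

definition Lp_space :: "ennreal \<Rightarrow> 'a measure \<Rightarrow> ('a \<Rightarrow> complex) set" where
  "Lp_space p m = {f \<in> borel_measurable m.
     if p = \<infinity> then esssup m (\<lambda>x. ennreal (norm (f x))) < \<infinity>
     else integrable m (\<lambda>x. norm (f x) powr enn2real p)}"

definition Lp_norm :: "ennreal \<Rightarrow> 'a measure \<Rightarrow> ('a \<Rightarrow> complex) \<Rightarrow> real" where
  "Lp_norm p m f =
     (if p = \<infinity> then enn2real (esssup m (\<lambda>x. ennreal (norm (f x))))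
      else (\<integral>x. norm (f x) powr enn2real p \<partial>m) powr (1 / enn2real p))"

definition fourier_coeff :: "'a measure \<Rightarrow> ('a \<Rightarrow> complex) \<Rightarrow> ('a \<Rightarrow> complex) \<Rightarrow> complex" where
  "fourier_coeff m f \<gamma> = (\<integral>x. f x * cnj (\<gamma> x) \<partial>m)"

definition Hp_group ::
  "(nat \<Rightarrow> real) \<Rightarrow> ('a, 'b) monoid_scheme \<Rightarrow> 'a topology \<Rightarrow> (real \<Rightarrow> 'a) \<Rightarrow> 'a measure \<Rightarrow>
     ennreal \<Rightarrow> ('a \<Rightarrow> complex) set" where
  "Hp_group lam G T \<beta> m p =
     {f \<in> Lp_space p m. \<forall>\<gamma>\<in>characters G T.
        fourier_coeff m f \<gamma> \<noteq> 0 \<longrightarrow> (\<exists>n. \<gamma> = freq_char G T \<beta> (lam n))}"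

text \<open>
  A \<open>lam\<close>-Dirichlet series is represented by its coefficient sequence. The functions with given
  Fourier coefficients at the \<open>lam n\<close> in the Hardy space on the group:
\<close>

definition Hp_functions ::
  "(nat \<Rightarrow> real) \<Rightarrow> ('a, 'b) monoid_scheme \<Rightarrow> 'a topology \<Rightarrow> (real \<Rightarrow> 'a) \<Rightarrow> 'a measure \<Rightarrow>
     ennreal \<Rightarrow> (nat \<Rightarrow> complex) \<Rightarrow> ('a \<Rightarrow> complex) set" where
  "Hp_functions lam G T \<beta> m p a =
     {f \<in> Hp_group lam G T \<beta> m p. \<forall>n. fourier_coeff m f (freq_char G T \<beta> (lam n)) = a n}"

definition Hp_dirichlet ::
  "(nat \<Rightarrow> real) \<Rightarrow> ('a, 'b) monoid_scheme \<Rightarrow> 'a topology \<Rightarrow> (real \<Rightarrow> 'a) \<Rightarrow> 'a measure \<Rightarrow>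
     ennreal \<Rightarrow> (nat \<Rightarrow> complex) set" where
  "Hp_dirichlet lam G T \<beta> m p = {a. Hp_functions lam G T \<beta> m p a \<noteq> {}}"

text \<open>
  The functions in \<open>Hp_functions lam G T \<beta> m p a\<close> have the same Fourier transform, so they agree
  almost everywhere; the infimum below is over a single number, the norm of any one of them.
\<close>

definition Hp_norm ::
  "(nat \<Rightarrow> real) \<Rightarrow> ('a, 'b) monoid_scheme \<Rightarrow> 'a topology \<Rightarrow> (real \<Rightarrow> 'a) \<Rightarrow> 'a measure \<Rightarrow>
     ennreal \<Rightarrow> (nat \<Rightarrow> complex) \<Rightarrow> real" where
  "Hp_norm lam G T \<beta> m p a = (INF f\<in>Hp_functions lam G T \<beta> m p a. Lp_norm p m f)"

text \<open>Operator norm, with value \<open>\<infinity>\<close> for unbounded operators.\<close>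

definition Hp_opnorm ::
  "(nat \<Rightarrow> real) \<Rightarrow> ('a, 'b) monoid_scheme \<Rightarrow> 'a topology \<Rightarrow> (real \<Rightarrow> 'a) \<Rightarrow> 'a measure \<Rightarrow>
     ennreal \<Rightarrow> ((nat \<Rightarrow> complex) \<Rightarrow> (nat \<Rightarrow> complex)) \<Rightarrow> ereal" where
  "Hp_opnorm lam G T \<beta> m p P =
     (SUP a\<in>{a \<in> Hp_dirichlet lam G T \<beta> m p. Hp_norm lam G T \<beta> m p a \<le> 1}.
        ereal (Hp_norm lam G T \<beta> m p (P a)))"

text \<open>By the indexing from \<open>0\<close>, \<open>partial_sum N\<close> keeps the first \<open>N + 1\<close> terms.\<close>

definition partial_sum :: "nat \<Rightarrow> (nat \<Rightarrow> complex) \<Rightarrow> (nat \<Rightarrow> complex)" where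
  "partial_sum N a = (\<lambda>n. if n \<le> N then a n else 0)"

end

theory Submission
  imports Defs "HOL-Probability.Probability_Measure" "HOL-Real_Asymp.Real_Asymp"
begin

text \<open>
  The partial sum operator is a Fourier multiplier: it multiplies the coefficient at the
  frequency \<open>x\<close> by \<open>\<Phi> x\<close>, for any \<open>\<Phi> :: real \<Rightarrow> real\<close> that is \<open>1\<close> on \<open>[0, lam N]\<close> and \<open>0\<close> on
  \<open>[lam (Suc N), \<infinity>)\<close>. So its norm on both spaces is at most the \<open>L\<^sub>1\<close>-norm of the inverse Fourier
  transform of \<open>\<Phi>\<close>. A triangle has norm equal to its height, since it is the transform of a
  nonnegative function, a Fejer kernel, and translates of it have the same norm. A suitable
  \<open>\<Phi>\<close> is a sum of triangles of height \<open>1/2\<close> whose widths double, from the width \<open>d\<close> of the gap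
  after \<open>lam N\<close> to about \<open>lam N\<close>, and of one triangle of height \<open>1\<close>
  (\<open>ex_step_multiplier\<close>). There are about \<open>log 2 (1 + lam N / d)\<close> of them, so the
  partial sum operator has norm at most \<open>ln (1 + lam N / d) + 2\<close>
  (\<open>Hp_opnorm_partial_sum_gap\<close>). Bohr's condition makes this logarithm linear in
  \<open>lam N\<close>, and Landau's condition makes it \<open>O(exp (\<delta> * lam N))\<close> for every \<open>\<delta> > 0\<close>.

  The proof carries this out with finite sums. The norm of a multiplier is replaced by the relation
  \<open>majorized \<Phi> \<Psi>\<close>, which compares the Hermitian form with matrix \<open>\<Phi> (u - v)\<close> with the positive
  semidefinite form with matrix \<open>\<Psi> (u - v)\<close>; the number \<open>\<Psi> 0\<close> then bounds the norm. On the
  group, let \<open>f\<close> have the coefficients \<open>a n\<close>, and let \<open>F\<close> be a finite set of frequencies of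
  characters. Convolving \<open>f\<close> with the trigonometric polynomial whose coefficient at \<open>d\<close> is
  \<open>\<Phi> d * card {(u, v) \<in> F \<times> F. u - v = d} / card F\<close> leaves the terms with \<open>n \<le> N\<close>, each
  multiplied by the proportion of \<open>F\<close> that stays in \<open>F\<close> under translation by \<open>lam n\<close>. This
  polynomial is dominated by the nonnegative one built from \<open>\<Psi>\<close>, whose integral is
  \<open>\<Psi> 0\<close> by orthogonality of the characters. Hence the convolution is bounded by
  \<open>\<Psi> 0\<close> times the norm of \<open>f\<close>, and the proportions are as close to \<open>1\<close> as required if
  \<open>F\<close> is almost invariant (\<open>ex_almost_invariant_set\<close>).
\<close>

section \<open>Majorized multipliers on the line\<close>

lemma norm_integral_le_integral:
  fixes f :: "'a \<Rightarrow> 'b::{banach, second_countable_topology}"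
  assumes "integrable M f" "integrable M g" "\<And>x. x \<in> space M \<Longrightarrow> norm (f x) \<le> g x"
  shows "norm (\<integral>x. f x \<partial>M) \<le> (\<integral>x. g x \<partial>M)"
  using assms by (intro order_trans[OF integral_norm_bound integral_mono]) auto

definition hat :: "real \<Rightarrow> real \<Rightarrow> real" where
  "hat w x = max 0 (1 - \<bar>x\<bar> / w)"

text \<open>
  An upper bound for the norm of the multiplier \<open>\<Phi>\<close>: if \<open>\<Phi>\<close> is the Fourier transform of
  \<open>\<phi>\<close>, and \<open>\<Psi>\<close> that of a function \<open>\<psi>\<close> with \<open>\<bar>\<phi>\<bar> \<le> \<psi>\<close>, then the two sums are the integrals of
  \<open>\<phi>\<close> and of \<open>\<psi>\<close> against the square of the modulus of \<open>\<lambda>t. \<Sum>u\<in>F. z u * exp (- \<i> * u * t)\<close>, and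
  \<open>\<Psi> 0\<close> is the integral of \<open>\<psi>\<close>.
\<close>

definition majorized :: "(real \<Rightarrow> real) \<Rightarrow> (real \<Rightarrow> real) \<Rightarrow> bool" where
  "majorized \<Phi> \<Psi> \<longleftrightarrow> (\<forall>(F :: real set) z. finite F \<longrightarrow>
     norm (\<Sum>u\<in>F. \<Sum>v\<in>F. of_real (\<Phi> (u - v)) * (z u * cnj (z v)))
       \<le> Re (\<Sum>u\<in>F. \<Sum>v\<in>F. of_real (\<Psi> (u - v)) * (z u * cnj (z v))))"

lemma majorized_add:
  assumes "majorized \<Phi> \<Psi>" "majorized \<Phi>' \<Psi>'"
  shows "majorized (\<lambda>x. \<Phi> x + \<Phi>' x) (\<lambda>x. \<Psi> x + \<Psi>' x)"
  unfolding majorized_def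
proof (intro allI impI)
  fix F :: "real set" and z :: "real \<Rightarrow> complex"
  assume "finite F"
  let ?S = "\<lambda>\<Phi>. \<Sum>u\<in>F. \<Sum>v\<in>F. of_real (\<Phi> (u - v)) * (z u * cnj (z v))"
  have add: "?S (\<lambda>x. \<Phi> x + \<Phi>' x) = ?S \<Phi> + ?S \<Phi>'" for \<Phi> \<Phi>' :: "real \<Rightarrow> real"
    by (simp add: distrib_right sum.distrib)
  have "norm (?S \<Phi>) \<le> Re (?S \<Psi>)" "norm (?S \<Phi>') \<le> Re (?S \<Psi>')"
    using assms \<open>finite F\<close> unfolding majorized_def by blast+
  then show "norm (?S (\<lambda>x. \<Phi> x + \<Phi>' x)) \<le> Re (?S (\<lambda>x. \<Psi> x + \<Psi>' x))"
    unfolding add plus_complex.sel by (meson add_mono norm_triangle_le)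
qed

lemma majorized_scale:
  assumes "majorized \<Phi> \<Psi>" "0 \<le> c"
  shows "majorized (\<lambda>x. c * \<Phi> x) (\<lambda>x. c * \<Psi> x)"
  unfolding majorized_def
proof (intro allI impI)
  fix F :: "real set" and z :: "real \<Rightarrow> complex"
  assume "finite F"
  let ?S = "\<lambda>\<Phi>. \<Sum>u\<in>F. \<Sum>v\<in>F. of_real (\<Phi> (u - v)) * (z u * cnj (z v))"
  have scale: "?S (\<lambda>x. c * \<Phi> x) = of_real c * ?S \<Phi>" for \<Phi> :: "real \<Rightarrow> real"
    by (simp add: sum_distrib_left mult.assoc)
  have "norm (?S \<Phi>) \<le> Re (?S \<Psi>)"
    using assms \<open>finite F\<close> unfolding majorized_def by blast
  then show "norm (?S (\<lambda>x. c * \<Phi> x)) \<le> Re (?S (\<lambda>x. c * \<Psi> x))"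
    unfolding scale using assms(2) by (simp add: norm_mult mult_left_mono)
qed

lemma majorized_sum:
  assumes "finite I" "\<And>i. i \<in> I \<Longrightarrow> majorized (\<Phi> i) (\<Psi> i)"
  shows "majorized (\<lambda>x. \<Sum>i\<in>I. \<Phi> i x) (\<lambda>x. \<Sum>i\<in>I. \<Psi> i x)"
  using assms
proof (induction I rule: finite_induct)
  case empty
  then show ?case by (simp add: majorized_def)
next
  case (insert i I)
  then show ?case by (simp add: majorized_add)
qed

lemma integral_interval_overlap:
  fixes w p q :: real
  assumes "0 < w"
  shows "(\<integral>s. indicat_real {p..p + w} s * indicat_real {q..q + w} s \<partial>lborel) = w * hat w (p - q)"
proof -
  have "(\<lambda>s. indicat_real {p..p + w} s * indicat_real {q..q + w} s)
      = indicat_real {max p q..min p q + w}"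
    by (auto simp: indicator_def fun_eq_iff)
  then have "(\<integral>s. indicat_real {p..p + w} s * indicat_real {q..q + w} s \<partial>lborel)
      = measure lborel {max p q..min p q + w}"
    by simp
  also have "\<dots> = max 0 (w - \<bar>p - q\<bar>)"
    by (auto simp: max_def min_def)
  also have "\<dots> = w * hat w (p - q)"
    using assms by (auto simp: hat_def max_def field_simps)
  finally show ?thesis .
qed

text \<open>
  The matrix of values of \<open>hat\<close> is the Gram matrix of translates of the indicator of an interval.
  The two families of left ends \<open>p\<close> and \<open>q\<close> allow a comparison of a system of intervals with
  its translate.
\<close>

lemma gram_hat:
  fixes z :: "real \<Rightarrow> complex" and p q :: "real \<Rightarrow> real"
  assumes "finite F" "0 < w"
  defines "A \<equiv> \<lambda>p s. \<Sum>u\<in>F. z u * of_real (indicat_real {p u..p u + w} s)"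
  shows "has_bochner_integral lborel (\<lambda>s. A p s * cnj (A q s))
    (of_real w * (\<Sum>u\<in>F. \<Sum>v\<in>F. of_real (hat w (p u - q v)) * (z u * cnj (z v))))"
proof -
  have expand: "A p s * cnj (A q s) = (\<Sum>u\<in>F. \<Sum>v\<in>F. z u * cnj (z v) *
      of_real (indicat_real {p u..p u + w} s * indicat_real {q v..q v + w} s))" for s
    by (simp add: A_def sum_product algebra_simps)
  have "integrable lborel (\<lambda>s. indicat_real {p u..p u + w} s * indicat_real {q v..q v + w} s)" for u v
    by (rule integrable_real_mult_indicator) (auto intro!: integrable_real_indicator simp: emeasure_lborel_Icc_eq)
  then have "has_bochner_integral lborel
      (\<lambda>s. indicat_real {p u..p u + w} s * indicat_real {q v..q v + w} s) (w * hat w (p u - q v))" for u v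
    by (simp add: has_bochner_integral_iff integral_interval_overlap[OF \<open>0 < w\<close>])
  then have "has_bochner_integral lborel (\<lambda>s. A p s * cnj (A q s))
      (\<Sum>u\<in>F. \<Sum>v\<in>F. z u * cnj (z v) * of_real (w * hat w (p u - q v)))"
    unfolding expand
    by (intro has_bochner_integral_sum has_bochner_integral_mult_right has_bochner_integral_of_real)
  then show ?thesis
    by (simp add: sum_distrib_left mult_ac)
qed

text \<open>
  Shifting the argument of \<open>hat w\<close> shifts one of the two systems of intervals in the Gram
  matrix. This changes neither of the two \<open>L\<^sub>2\<close>-norms, so the arithmetic-geometric mean
  inequality applies. In terms of Fourier transforms, a translation multiplies the nonnegative
  Fejer kernel by a factor of modulus \<open>1\<close>.
\<close>

lemma majorized_hat_translate:
  assumes "0 < w"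
  shows "majorized (\<lambda>x. hat w (x - c)) (hat w)"
  unfolding majorized_def
proof (intro allI impI)
  fix F :: "real set" and z :: "real \<Rightarrow> complex"
  assume "finite F"
  define A where "A p s = (\<Sum>u\<in>F. z u * of_real (indicat_real {p u..p u + w} s))"
    for p :: "real \<Rightarrow> real" and s
  define S where "S c = (\<Sum>u\<in>F. \<Sum>v\<in>F. of_real (hat w (u - v - c)) * (z u * cnj (z v)))" for c
  define B where "B = A (\<lambda>u. u - c)"
  define D where "D = A (\<lambda>u. u)"
  note gram = gram_hat[OF \<open>finite F\<close> \<open>0 < w\<close>, of z, folded A_def]
  have BD: "has_bochner_integral lborel (\<lambda>s. B s * cnj (D s)) (of_real w * S c)"
    using gram[of "\<lambda>u. u - c" "\<lambda>u. u"] by (simp add: B_def D_def S_def algebra_simps)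
  have "has_bochner_integral lborel (\<lambda>s. B s * cnj (B s)) (of_real w * S 0)"
    using gram[of "\<lambda>u. u - c" "\<lambda>u. u - c"] by (simp add: B_def S_def)
  from has_bochner_integral_Re[OF this]
  have BB: "has_bochner_integral lborel (\<lambda>s. (norm (B s))\<^sup>2) (w * Re (S 0))"
    by (simp add: complex_mult_cnj cmod_def)
  have "has_bochner_integral lborel (\<lambda>s. D s * cnj (D s)) (of_real w * S 0)"
    using gram[of "\<lambda>u. u" "\<lambda>u. u"] by (simp add: D_def S_def)
  from has_bochner_integral_Re[OF this]
  have DD: "has_bochner_integral lborel (\<lambda>s. (norm (D s))\<^sup>2) (w * Re (S 0))"
    by (simp add: complex_mult_cnj cmod_def)
  have "has_bochner_integral lborel (\<lambda>s. (norm (B s))\<^sup>2 + (norm (D s))\<^sup>2) (w * Re (S 0) + w * Re (S 0))"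
    by (rule has_bochner_integral_add[OF BB DD])
  then have half: "has_bochner_integral lborel (\<lambda>s. ((norm (B s))\<^sup>2 + (norm (D s))\<^sup>2) / 2) (w * Re (S 0))"
    by (auto simp: has_bochner_integral_iff)
  have "norm (\<integral>s. B s * cnj (D s) \<partial>lborel) \<le> (\<integral>s. ((norm (B s))\<^sup>2 + (norm (D s))\<^sup>2) / 2 \<partial>lborel)"
  proof (rule norm_integral_le_integral)
    fix s
    have "0 \<le> (norm (B s) - norm (D s))\<^sup>2" by simp
    then show "norm (B s * cnj (D s)) \<le> ((norm (B s))\<^sup>2 + (norm (D s))\<^sup>2) / 2"
      by (simp add: norm_mult power2_diff)
  qed (use BD half in \<open>auto simp: has_bochner_integral_iff\<close>)
  also have "\<dots> = w * Re (S 0)"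
    using half by (rule has_bochner_integral_integral_eq)
  finally have "w * norm (S c) \<le> w * Re (S 0)"
    using BD \<open>0 < w\<close> by (simp add: has_bochner_integral_iff norm_mult)
  then show "norm (\<Sum>u\<in>F. \<Sum>v\<in>F. of_real (hat w (u - v - c)) * (z u * cnj (z v)))
      \<le> Re (\<Sum>u\<in>F. \<Sum>v\<in>F. of_real (hat w (u - v)) * (z u * cnj (z v)))"
    using \<open>0 < w\<close> by (simp add: S_def)
qed

text \<open>
  The truncated ramp with slope \<open>1 / w\<close> minus the one with half the slope is a triangle of
  height \<open>1/2\<close> with peak at \<open>w\<close>.
\<close>

lemma hat_halving:
  assumes "0 < w" "0 \<le> y"
  shows "1/2 * hat w (w - y) + min 1 (y / (2 * w)) = min 1 (y / w)"
  using assms by (auto simp: hat_def max_def min_def field_simps abs_if split: if_splits)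

lemma dyadic_hats_sum:
  assumes "0 < d" "0 \<le> y"
  shows "(\<Sum>j<J. 1/2 * hat (2^j * d) (2^j * d - y)) + min 1 (y / (2^J * d)) = min 1 (y / d)"
proof (induction J)
  case (Suc J)
  have "1/2 * hat (2^J * d) (2^J * d - y) + min 1 (y / (2^Suc J * d)) = min 1 (y / (2^J * d))"
    using hat_halving[of "2^J * d" y] assms by (simp add: mult.assoc)
  with Suc show ?case by simp
qed simp

text \<open>
  By telescoping, dyadic triangles reduce the ramp of width \<open>d\<close> to the ramp of width
  \<open>2^J * d\<close>. The latter reaches at least from \<open>a + d\<close> down to \<open>0\<close>, and there it coincides with one
  side of one more triangle. All the triangles end at \<open>a + d\<close> on the right.
\<close>

lemma ex_step_multiplier:
  assumes "0 < d" "a + d \<le> 2^J * d"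
  obtains \<Phi> \<Psi> where "majorized \<Phi> \<Psi>" "\<Psi> 0 = real J / 2 + 1"
    "\<And>x. 0 \<le> x \<Longrightarrow> x \<le> a \<Longrightarrow> \<Phi> x = 1" "\<And>x. a + d \<le> x \<Longrightarrow> \<Phi> x = 0"
proof
  define b where "b = a + d"
  let ?\<Phi> = "\<lambda>x. (\<Sum>j<J. 1/2 * hat (2^j * d) (x - (b - 2^j * d))) + hat (2^J * d) (x - (b - 2^J * d))"
  let ?\<Psi> = "\<lambda>x. (\<Sum>j<J. 1/2 * hat (2^j * d) x) + hat (2^J * d) x"
  show "majorized ?\<Phi> ?\<Psi>"
    using \<open>0 < d\<close>
    by (intro majorized_add majorized_sum majorized_scale majorized_hat_translate) auto
  show "?\<Psi> 0 = real J / 2 + 1"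
    by (simp add: hat_def)
  show "?\<Phi> x = 1" if "0 \<le> x" "x \<le> a" for x
  proof -
    \<comment> \<open>The ramps start at \<open>b\<close> and rise to the left, so \<open>y\<close> is the natural variable.\<close>
    define y where "y = b - x"
    have y: "d \<le> y" "y \<le> 2^J * d"
      using that assms by (auto simp: y_def b_def)
    have "?\<Phi> x = (\<Sum>j<J. 1/2 * hat (2^j * d) (2^j * d - y)) + hat (2^J * d) (2^J * d - y)"
      by (simp add: y_def algebra_simps)
    also have "hat (2^J * d) (2^J * d - y) = min 1 (y / (2^J * d))"
      using y \<open>0 < d\<close> by (simp add: hat_def field_simps)
    also have "(\<Sum>j<J. 1/2 * hat (2^j * d) (2^j * d - y)) + min 1 (y / (2^J * d)) = min 1 (y / d)"
      using y \<open>0 < d\<close> by (intro dyadic_hats_sum) auto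
    also have "\<dots> = 1"
      using y \<open>0 < d\<close> by simp
    finally show ?thesis .
  qed
  show "?\<Phi> x = 0" if "a + d \<le> x" for x
  proof -
    have "hat (2^j * d) (x - (b - 2^j * d)) = 0" for j
      using that \<open>0 < d\<close> by (auto simp: hat_def b_def max_def field_simps abs_if)
    then show ?thesis by simp
  qed
qed

section \<open>Almost invariant finite sets\<close>

definition lattice_box :: "'a::comm_ring_1 set \<Rightarrow> nat \<Rightarrow> 'a set" where
  "lattice_box A M = (\<lambda>k. \<Sum>a\<in>A. of_nat (k a) * a) ` (A \<rightarrow>\<^sub>E {..<M})"

lemma
  assumes "finite A"
  shows finite_lattice_box: "finite (lattice_box A M)"
    and card_lattice_box_le: "card (lattice_box A M) \<le> M ^ card A"
proof -
  have fin: "finite (A \<rightarrow>\<^sub>E {..<M})"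
    using assms by (intro finite_PiE) auto
  then show "finite (lattice_box A M)"
    by (simp add: lattice_box_def)
  have "card (lattice_box A M) \<le> card (A \<rightarrow>\<^sub>E {..<M})"
    unfolding lattice_box_def using fin by (rule card_image_le)
  then show "card (lattice_box A M) \<le> M ^ card A"
    using assms by (simp add: card_PiE)
qed

lemma lattice_box_mono:
  "lattice_box A M \<subseteq> lattice_box A (Suc M)"
  unfolding lattice_box_def by (intro image_mono PiE_mono) auto

lemma lattice_box_translate:
  assumes "finite A" "a \<in> A" "x \<in> lattice_box A M"
  shows "x + a \<in> lattice_box A (Suc M)"
proof -
  obtain k where k: "k \<in> A \<rightarrow>\<^sub>E {..<M}" "x = (\<Sum>b\<in>A. of_nat (k b) * b)"
    using assms(3) by (auto simp: lattice_box_def)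
  have "(\<Sum>b\<in>A. of_nat ((k(a := Suc (k a))) b) * b) = (\<Sum>b\<in>A. of_nat (k b) * b + (if b = a then a else 0))"
    by (intro sum.cong) (auto simp: algebra_simps)
  also have "\<dots> = x + a"
    using assms by (simp add: sum.distrib k)
  finally have "x + a = (\<Sum>b\<in>A. of_nat ((k(a := Suc (k a))) b) * b)" ..
  moreover have "k(a := Suc (k a)) \<in> A \<rightarrow>\<^sub>E {..<Suc M}"
    using k(1) assms(2) by (auto simp: PiE_iff extensional_def)
  ultimately show ?thesis
    unfolding lattice_box_def by blast
qed

lemma lattice_box_subset:
  assumes "finite A" "A \<subseteq> X" "0 \<in> X" "\<And>x y. x \<in> X \<Longrightarrow> y \<in> X \<Longrightarrow> x + y \<in> X"
  shows "lattice_box A M \<subseteq> X"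
proof -
  have mult: "of_nat n * a \<in> X" if "a \<in> A" for a and n :: nat
    using that assms by (induction n) (auto simp: distrib_right)
  have "(\<Sum>a\<in>B. of_nat (k a) * a) \<in> X" if "B \<subseteq> A" for B and k :: "'a \<Rightarrow> nat"
    using finite_subset[OF that \<open>finite A\<close>] that
    by (induction B rule: finite_induct) (auto simp: assms mult)
  then show ?thesis by (auto simp: lattice_box_def)
qed

text \<open>
  A sequence of polynomial growth cannot gain a fixed factor at every step.
\<close>

lemma ex_slow_growth:
  fixes c :: "nat \<Rightarrow> real"
  assumes "0 < \<epsilon>" "\<And>M. 1 \<le> M \<Longrightarrow> 1 \<le> c M" "\<And>M. c M \<le> real M ^ n"
  obtains M where "1 \<le> M" "c (Suc M) \<le> (1 + \<epsilon>) * c M"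
proof (rule ccontr)
  assume "\<not> thesis"
  with that have fast: "(1 + \<epsilon>) * c M < c (Suc M)" if "1 \<le> M" for M
    using \<open>1 \<le> M\<close> by force
  have "(1 + \<epsilon>) ^ M \<le> c (Suc M)" for M
  proof (induction M)
    case (Suc M)
    then have "(1 + \<epsilon>) * (1 + \<epsilon>) ^ M \<le> (1 + \<epsilon>) * c (Suc M)"
      using \<open>0 < \<epsilon>\<close> by (intro mult_left_mono) auto
    with fast[of "Suc M"] show ?case by simp
  qed (simp add: assms)
  with assms(3) have "(1 + \<epsilon>) ^ M \<le> real (Suc M) ^ n" for M
    by (meson order_trans)
  moreover have "eventually (\<lambda>M. real (Suc M) ^ n < (1 + \<epsilon>) ^ M) sequentially"
    using \<open>0 < \<epsilon>\<close> by real_asymp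
  ultimately show False
    by (auto simp: eventually_sequentially not_less[symmetric])
qed

text \<open>
  A Foelner set for a finitely generated abelian group. The boxes
  \<open>lattice_box A M\<close> have polynomial growth, so some box exceeds its predecessor only by a
  proportion \<open>\<epsilon>\<close>; its predecessor is almost invariant, because all its translates by elements
  of \<open>A\<close> lie in the next box.
\<close>

lemma ex_almost_invariant_set:
  fixes A X :: "'a::{comm_ring_1} set"
  assumes "finite A" "A \<subseteq> X" "0 \<in> X" "\<And>x y. x \<in> X \<Longrightarrow> y \<in> X \<Longrightarrow> x + y \<in> X" "0 < \<epsilon>"
  obtains F where "finite F" "F \<noteq> {}" "F \<subseteq> X"
    "\<And>a. a \<in> A \<Longrightarrow> (1 - \<epsilon>) * real (card F) \<le> real (card {v\<in>F. v + a \<in> F})"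
proof -
  let ?c = "\<lambda>M. real (card (lattice_box A M))"
  have nonempty: "lattice_box A M \<noteq> {}" if "1 \<le> M" for M
    using that by (auto simp: lattice_box_def PiE_eq_empty_iff lessThan_empty_iff)
  have "1 \<le> ?c M" if "1 \<le> M" for M
    using nonempty[OF that] finite_lattice_box[OF \<open>finite A\<close>, of M] 
    by (simp add: Suc_le_eq card_gt_0_iff)
  moreover have "?c M \<le> real M ^ card A" for M
    using card_lattice_box_le[OF \<open>finite A\<close>, of M] by (simp flip: of_nat_power)
  ultimately obtain M where M: "1 \<le> M" "?c (Suc M) \<le> (1 + \<epsilon>) * ?c M"
    using ex_slow_growth[OF \<open>0 < \<epsilon>\<close>, of ?c "card A"] by blast
  let ?F = "lattice_box A M" and ?F' = "lattice_box A (Suc M)"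
  have fin: "finite ?F" "finite ?F'"
    using finite_lattice_box \<open>finite A\<close> by blast+
  show thesis
  proof
    show "finite ?F" "?F \<noteq> {}" "?F \<subseteq> X"
      using fin nonempty M(1) lattice_box_subset[OF assms(1-4)] by blast+
    fix a assume "a \<in> A"
    have inj: "inj_on (\<lambda>v. v + a) S" for S
      by (simp add: inj_on_def)
    have "card ?F = card {v\<in>?F. v + a \<in> ?F} + card {v\<in>?F. v + a \<notin> ?F}"
      using fin by (subst card_Un_disjoint[symmetric]) (auto intro: arg_cong[of _ _ card])
    moreover have "card {v\<in>?F. v + a \<notin> ?F} = card ((\<lambda>v. v + a) ` {v\<in>?F. v + a \<notin> ?F})"
      by (simp add: card_image[OF inj])
    moreover have "card ((\<lambda>v. v + a) ` {v\<in>?F. v + a \<notin> ?F}) \<le> card (?F' - ?F)"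
      using fin lattice_box_translate[OF \<open>finite A\<close> \<open>a \<in> A\<close>] by (intro card_mono) auto
    moreover have "card (?F' - ?F) = card ?F' - card ?F" "card ?F \<le> card ?F'"
      using fin lattice_box_mono[of A M] by (auto intro: card_Diff_subset card_mono)
    ultimately have "real (card ?F) \<le> real (card {v\<in>?F. v + a \<in> ?F}) + (?c (Suc M) - ?c M)"
      by linarith
    with M(2) show "(1 - \<epsilon>) * real (card ?F) \<le> real (card {v\<in>?F. v + a \<in> ?F})"
      by (simp add: algebra_simps)
  qed
qed

text \<open>
  Sums over \<open>F \<times> F\<close> of functions of the difference give the difference \<open>d\<close> the weight
  \<open>card {v\<in>F. v + d \<in> F}\<close>; these are the coefficients of the square of the modulus of
  \<open>\<Sum>u\<in>F. chi u\<close>, which plays the part of a Fejer kernel on the group.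
\<close>

lemma sum_over_differences:
  fixes F :: "'a :: ab_group_add set" and c :: "'b :: semiring_1"
  assumes "finite F"
  shows "(\<Sum>u\<in>F. \<Sum>v\<in>F. if u - v = d then c else 0) = of_nat (card {v\<in>F. v + d \<in> F}) * c"
proof -
  have "(\<Sum>u\<in>F. \<Sum>v\<in>F. if u - v = d then c else 0) = (\<Sum>v\<in>F. \<Sum>u\<in>F. if u = v + d then c else 0)"
    by (subst sum.swap) (intro sum.cong refl if_cong, auto simp: algebra_simps)
  also have "\<dots> = (\<Sum>v\<in>F. if v + d \<in> F then c else 0)"
    using assms by simp
  also have "\<dots> = (\<Sum>v\<in>{v\<in>F. v + d \<in> F}. c)"
    using assms by (rule sum.inter_filter[symmetric])
  finally show ?thesis by simp
qed

lemma sum_diagonal: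
  fixes F :: "'a :: ab_group_add set" and c :: "'b :: semiring_1"
  assumes "finite F"
  shows "(\<Sum>u\<in>F. \<Sum>v\<in>F. if u - v = 0 then c else 0) = of_nat (card F) * c"
  using sum_over_differences[OF assms, of 0 c] by simp

section \<open>Characters and Haar measure\<close>

locale haar_dirichlet_group = dirichlet_group G T \<beta>
  for G (structure) and T and \<beta> :: "real \<Rightarrow> 'a" +
  fixes m :: "'a measure"
  assumes haar: "normalized_haar_measure G T m"
begin

text \<open>
  Only characters that are known to exist can be used, which need not be all exponentials on
  the line. The frequencies at which they exist form a subgroup of the reals.
\<close>

definition freqs :: "real set" where
  "freqs = {u. \<exists>h\<in>characters G T. \<forall>t. h (\<beta> t) = exp (- \<i> * of_real (u * t))}"

abbreviation chi :: "real \<Rightarrow> 'a \<Rightarrow> complex" where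
  "chi \<equiv> freq_char G T \<beta>"

lemma space_m [simp]: "space m = carrier G"
  using haar by (simp add: normalized_haar_measure_def)

lemma prob_space_m: "prob_space m"
  using haar by (intro prob_spaceI) (simp add: normalized_haar_measure_def)

sublocale prob_space m
  by (rule prob_space_m)

lemma \<beta>_carrier [simp]: "\<beta> t \<in> carrier G"
  using continuous_\<beta> topspace_eq by (auto simp: continuous_map_def)

lemma freq_char_unique:
  assumes "h \<in> characters G T" "\<And>t. h (\<beta> t) = exp (- \<i> * of_real (u * t))"
  shows "chi u = h"
  unfolding freq_char_def using assms
  by (intro the_equality) (auto intro!: character_eqI)

lemma freqsI:
  assumes "h \<in> characters G T" "\<And>t. h (\<beta> t) = exp (- \<i> * of_real (u * t))"
  shows "u \<in> freqs"
  using assms by (auto simp: freqs_def)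

lemma chi_character: "u \<in> freqs \<Longrightarrow> chi u \<in> characters G T"
  and chi_\<beta>: "u \<in> freqs \<Longrightarrow> chi u (\<beta> t) = exp (- \<i> * of_real (u * t))"
  by (auto simp: freqs_def freq_char_unique)

lemma norm_character [simp]:
  "\<gamma> \<in> characters G T \<Longrightarrow> x \<in> carrier G \<Longrightarrow> norm (\<gamma> x) = 1"
  by (auto simp: characters_def PiE_iff)

lemma character_mult:
  "\<gamma> \<in> characters G T \<Longrightarrow> x \<in> carrier G \<Longrightarrow> y \<in> carrier G \<Longrightarrow> \<gamma> (x \<otimes> y) = \<gamma> x * \<gamma> y"
  by (auto simp: characters_def)

lemma trivial_character: "restrict (\<lambda>_. 1) (carrier G) \<in> characters G T"
proof -
  have "continuous_map T euclidean (restrict (\<lambda>_. 1 :: complex) (carrier G))"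
    by (rule continuous_map_eq[of _ _ "\<lambda>_. 1"]) (auto simp: topspace_eq)
  then show ?thesis
    by (auto simp: characters_def)
qed

lemma character_times_cnj:
  assumes "\<gamma> \<in> characters G T" "\<eta> \<in> characters G T"
  shows "restrict (\<lambda>x. \<gamma> x * cnj (\<eta> x)) (carrier G) \<in> characters G T"
proof -
  have "continuous_map T euclidean (\<lambda>x. \<gamma> x * cnj (\<eta> x))"
    using assms by (auto simp: characters_def continuous_map_atin intro!: tendsto_mult tendsto_cnj)
  then have "continuous_map T euclidean (restrict (\<lambda>x. \<gamma> x * cnj (\<eta> x)) (carrier G))"
    by (rule continuous_map_eq) (auto simp: topspace_eq)
  then show ?thesis
    using assms norm_character
    by (auto simp: characters_def norm_mult)
qed

lemma zero_freqs: "0 \<in> freqs"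
  and chi_zero: "x \<in> carrier G \<Longrightarrow> chi 0 x = 1"
proof -
  have \<beta>: "restrict (\<lambda>_. 1) (carrier G) (\<beta> t) = exp (- \<i> * of_real (0 * t))" for t
    by simp
  show "0 \<in> freqs"
    by (rule freqsI[OF trivial_character \<beta>])
  show "x \<in> carrier G \<Longrightarrow> chi 0 x = 1"
    using freq_char_unique[OF trivial_character \<beta>] by simp
qed

lemma
  assumes "u \<in> freqs" "v \<in> freqs"
  shows diff_freqs: "u - v \<in> freqs"
    and chi_diff: "x \<in> carrier G \<Longrightarrow> chi (u - v) x = chi u x * cnj (chi v x)"
proof -
  note char = character_times_cnj[OF chi_character[OF assms(1)] chi_character[OF assms(2)]]
  have \<beta>: "restrict (\<lambda>x. chi u x * cnj (chi v x)) (carrier G) (\<beta> t) = exp (- \<i> * of_real ((u - v) * t))" for t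
    using chi_\<beta>[OF assms(1)] chi_\<beta>[OF assms(2)]
    by (simp add: exp_cnj algebra_simps flip: exp_add)
  show "u - v \<in> freqs"
    by (rule freqsI[OF char \<beta>])
  show "x \<in> carrier G \<Longrightarrow> chi (u - v) x = chi u x * cnj (chi v x)"
    using freq_char_unique[OF char \<beta>] by simp
qed

lemma add_freqs:
  assumes "u \<in> freqs" "v \<in> freqs"
  shows "u + v \<in> freqs"
  using diff_freqs[OF assms(1) diff_freqs[OF zero_freqs assms(2)]] by simp

lemma chi_inject:
  assumes "u \<in> freqs" "v \<in> freqs" "chi u = chi v"
  shows "u = v"
proof (rule ccontr)
  assume "u \<noteq> v"
  let ?t = "pi / (u - v)"
  have "exp (- \<i> * of_real ((u - v) * ?t)) = chi (u - v) (\<beta> ?t)"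
    using diff_freqs[OF assms(1,2)] by (rule chi_\<beta>[symmetric])
  also have "\<dots> = chi v (\<beta> ?t) * cnj (chi v (\<beta> ?t))"
    using chi_diff[OF assms(1,2)] assms(3) by simp
  also have "\<dots> = 1"
    using norm_character[OF chi_character[OF assms(2)], of "\<beta> ?t"]
    by (simp flip: complex_norm_square)
  finally show False
    using \<open>u \<noteq> v\<close> by (simp add: exp_minus)
qed

lemma openin_sets: "openin T U \<Longrightarrow> U \<in> sets m"
  using haar by (auto simp: normalized_haar_measure_def)

lemma character_measurable :
  assumes "\<gamma> \<in> characters G T"
  shows "\<gamma> \<in> borel_measurable m"
proof (rule borel_measurableI)
  fix S :: "complex set" assume "open S"
  then have "openin T {x \<in> topspace T. \<gamma> x \<in> S}"
    using assms by (intro openin_continuous_map_preimage[of _ euclidean]) (auto simp: characters_def)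
  moreover have "{x \<in> topspace T. \<gamma> x \<in> S} = \<gamma> -` S \<inter> space m"
    by (auto simp: topspace_eq)
  ultimately show "\<gamma> -` S \<inter> space m \<in> sets m"
    using openin_sets by auto
qed

lemma cnj_character_measurable:
  assumes "\<gamma> \<in> characters G T"
  shows "(\<lambda>x. cnj (\<gamma> x)) \<in> borel_measurable m"
  by (intro measurable_compose[OF character_measurable[OF assms]] borel_measurable_continuous_onI
      continuous_intros)

lemma translation_measurable:
  assumes "a \<in> carrier G"
  shows "(\<lambda>y. a \<otimes> y) \<in> measurable m m"
proof -
  have "sets m = sigma_sets (carrier G) {U. openin T U}"
    using haar by (simp add: normalized_haar_measure_def)
  then show ?thesis
  proof (rule measurable_sigma_sets)
    show "{U. openin T U} \<subseteq> Pow (carrier G)"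
      using openin_subset topspace_eq by blast
    show "(\<lambda>y. a \<otimes> y) \<in> space m \<rightarrow> carrier G"
      using assms by auto
    fix U assume "U \<in> {U. openin T U}"
    moreover have "continuous_map T (prod_topology T T) (\<lambda>y. (a, y))"
      using assms topspace_eq by (auto simp: continuous_map_pairwise o_def)
    then have "continuous_map T T ((\<lambda>(x, y). x \<otimes> y) \<circ> (\<lambda>y. (a, y)))"
      using continuous_mult by (rule continuous_map_compose)
    ultimately have "openin T {y \<in> topspace T. a \<otimes> y \<in> U}"
      by (intro openin_continuous_map_preimage[of T T]) (auto simp: o_def)
    moreover have "{y \<in> topspace T. a \<otimes> y \<in> U} = (\<lambda>y. a \<otimes> y) -` U \<inter> space m"
      by (auto simp: topspace_eq)
    ultimately show "(\<lambda>y. a \<otimes> y) -` U \<inter> space m \<in> sets m"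
      using openin_sets by auto
  qed
qed

text \<open>
  The hypothesis on Haar measure concerns images under a translation, while integrals need
  preimages: these are images under the translation by the inverse.
\<close>

lemma distr_translation:
  assumes "a \<in> carrier G"
  shows "distr m m (\<lambda>y. a \<otimes> y) = m"
proof (rule measure_eqI)
  fix A assume "A \<in> sets (distr m m (\<lambda>y. a \<otimes> y))"
  then have A: "A \<in> sets m" by simp
  have "A \<subseteq> carrier G"
    using sets.sets_into_space[OF A] by simp
  then have "(\<lambda>y. a \<otimes> y) -` A \<inter> space m = (\<lambda>y. inv a \<otimes> y) ` A"
    using assms inv_solve_left[OF _ assms] by (force simp: image_iff inv_solve_left m_assoc[symmetric])
  then show "emeasure (distr m m (\<lambda>y. a \<otimes> y)) A = emeasure m A"
    using A assms haar translation_measurable[OF assms]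
    by (simp add: emeasure_distr normalized_haar_measure_def)
qed simp

lemma integral_translation:
  fixes f :: "'a \<Rightarrow> complex"
  assumes "a \<in> carrier G" "f \<in> borel_measurable m"
  shows "(\<integral>y. f (a \<otimes> y) \<partial>m) = (\<integral>y. f y \<partial>m)"
  using integral_distr[OF translation_measurable[OF assms(1)] assms(2)]
  by (simp add: distr_translation[OF assms(1)])

text \<open>
  Distinct characters differ on the dense subgroup \<open>range \<beta>\<close>. Translating by a point where
  they differ multiplies the integral by a number other than \<open>1\<close>.
\<close>

lemma characters_orthonormal:
  assumes \<gamma>: "\<gamma> \<in> characters G T" and \<eta>: "\<eta> \<in> characters G T"
  shows "(\<integral>x. \<gamma> x * cnj (\<eta> x) \<partial>m) = (if \<gamma> = \<eta> then 1 else 0)"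
proof (cases "\<gamma> = \<eta>")
  case True
  have "(\<integral>x. \<gamma> x * cnj (\<gamma> x) \<partial>m) = (\<integral>x. 1 \<partial>m)"
    using \<gamma> by (intro Bochner_Integration.integral_cong)
      (auto simp: complex_mult_cnj complex_norm_square[symmetric] simp flip: cmod_power2)
  with True show ?thesis
    using prob_space by simp
next
  case False
  then obtain t where t: "\<gamma> (\<beta> t) \<noteq> \<eta> (\<beta> t)"
    using character_eqI[OF \<gamma> \<eta>] by auto
  let ?I = "\<integral>x. \<gamma> x * cnj (\<eta> x) \<partial>m"
  have "?I = (\<integral>x. \<gamma> (\<beta> t \<otimes> x) * cnj (\<eta> (\<beta> t \<otimes> x)) \<partial>m)"
    by (intro integral_translation[symmetric] borel_measurable_times character_measurable
        cnj_character_measurable \<gamma> \<eta> \<beta>_carrier)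
  also have "\<dots> = (\<integral>x. (\<gamma> (\<beta> t) * cnj (\<eta> (\<beta> t))) * (\<gamma> x * cnj (\<eta> x)) \<partial>m)"
    using \<gamma> \<eta> by (intro Bochner_Integration.integral_cong) (auto simp: character_mult)
  also have "\<dots> = (\<gamma> (\<beta> t) * cnj (\<eta> (\<beta> t))) * ?I"
    by simp
  finally have "?I = (\<gamma> (\<beta> t) * cnj (\<eta> (\<beta> t))) * ?I" .
  moreover have "\<gamma> (\<beta> t) * cnj (\<eta> (\<beta> t)) \<noteq> 1"
  proof
    assume 1: "\<gamma> (\<beta> t) * cnj (\<eta> (\<beta> t)) = 1"
    have "\<gamma> (\<beta> t) * (cnj (\<eta> (\<beta> t)) * \<eta> (\<beta> t)) = \<eta> (\<beta> t)"
      using 1 by (simp flip: mult.assoc)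
    moreover have "cnj (\<eta> (\<beta> t)) * \<eta> (\<beta> t) = 1"
      using \<eta> by (simp add: mult.commute[of "cnj _"] flip: complex_norm_square)
    ultimately show False
      using t by simp
  qed
  ultimately show ?thesis
    using False by simp
qed

lemma integral_chi:
  assumes "u \<in> freqs"
  shows "(\<integral>x. chi u x \<partial>m) = (if u = 0 then 1 else 0)"
proof -
  have "(\<integral>x. chi u x \<partial>m) = (\<integral>x. chi u x * cnj (chi 0 x) \<partial>m)"
    by (intro Bochner_Integration.integral_cong) (auto simp: chi_zero)
  also have "\<dots> = (if chi u = chi 0 then 1 else 0)"
    using assms zero_freqs by (intro characters_orthonormal chi_character)
  finally show ?thesis
    using chi_inject[OF assms zero_freqs] by auto
qed

lemma integrable_mult_bounded:
  fixes f g :: "'a \<Rightarrow> complex"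
  assumes "integrable m f" "g \<in> borel_measurable m" "\<And>x. x \<in> carrier G \<Longrightarrow> norm (g x) \<le> B"
  shows "integrable m (\<lambda>x. f x * g x)"
proof (rule Bochner_Integration.integrable_bound)
  show "integrable m (\<lambda>x. of_real B * f x)"
    using assms(1) by simp
  show "AE x in m. norm (f x * g x) \<le> norm (of_real B * f x)"
  proof (rule AE_I2)
    fix x assume "x \<in> space m"
    then have "norm (g x) \<le> \<bar>B\<bar>" using assms(3)[of x] by simp
    then show "norm (f x * g x) \<le> norm (of_real B * f x)"
      by (subst mult.commute) (simp add: norm_mult mult_right_mono)
  qed
qed (use assms in \<open>auto intro: borel_measurable_times\<close>)

lemma integrable_mult_cnj_character:
  fixes f :: "'a \<Rightarrow> complex"
  assumes "integrable m f" "\<gamma> \<in> characters G T"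
  shows "integrable m (\<lambda>x. f x * cnj (\<gamma> x))"
  using assms
  by (intro integrable_mult_bounded[where B = 1] cnj_character_measurable) auto

lemma integrable_character:
  assumes "\<gamma> \<in> characters G T"
  shows "integrable m \<gamma>"
  using assms by (intro integrable_const_bound[where B = 1] character_measurable) auto


text \<open>
  Up to the factor \<open>card F\<close>, the convolution kernel, as a function of \<open>x\<close> and \<open>y\<close>, that comes from
  the Fejer-like kernel of \<open>F\<close> and the multiplier \<open>\<Psi>\<close>.
\<close>

definition majorant_kernel :: "(real \<Rightarrow> real) \<Rightarrow> real set \<Rightarrow> 'a \<Rightarrow> 'a \<Rightarrow> real" where
  "majorant_kernel \<Psi> F x y = Re (\<Sum>u\<in>F. \<Sum>v\<in>F. of_real (\<Psi> (u - v)) * (chi (u - v) x * cnj (chi (u - v) y)))"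

lemma chi_diff_mult_cnj:
  assumes "F \<subseteq> freqs" "u \<in> F" "v \<in> F" "x \<in> carrier G" "y \<in> carrier G"
  shows "chi (u - v) x * cnj (chi (u - v) y)
    = (chi u x * cnj (chi u y)) * cnj (chi v x * cnj (chi v y))"
  using assms chi_diff[of u v] by (auto simp: subset_iff)

text \<open>
  At fixed points \<open>x\<close> and \<open>y\<close>, the kernels are the values of the Hermitian forms at the vector
  \<open>z u = chi u x * cnj (chi u y)\<close>.
\<close>

lemma norm_kernel_sum_le:
  assumes "majorized \<Phi> \<Psi>" "finite F" "F \<subseteq> freqs" "x \<in> carrier G" "y \<in> carrier G"
  shows "norm (\<Sum>u\<in>F. \<Sum>v\<in>F. of_real (\<Phi> (u - v)) * (chi (u - v) x * cnj (chi (u - v) y)))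
    \<le> majorant_kernel \<Psi> F x y"
proof -
  let ?z = "\<lambda>u. chi u x * cnj (chi u y)"
  have eq: "(\<Sum>u\<in>F. \<Sum>v\<in>F. of_real (\<Phi> (u - v)) * (chi (u - v) x * cnj (chi (u - v) y)))
      = (\<Sum>u\<in>F. \<Sum>v\<in>F. of_real (\<Phi> (u - v)) * (?z u * cnj (?z v)))" for \<Phi> :: "real \<Rightarrow> real"
    using assms(3-5) by (intro sum.cong refl arg_cong2[of _ _ _ _ "(*)"] chi_diff_mult_cnj)
  show ?thesis
    unfolding majorant_kernel_def eq using assms(1,2) by (simp only: majorized_def)
qed

lemma has_bochner_integral_kernel:
  assumes "finite F" "F \<subseteq> freqs" "integrable m f" "x \<in> carrier G"
  shows "has_bochner_integral m
    (\<lambda>y. f y * (\<Sum>u\<in>F. \<Sum>v\<in>F. of_real (\<Phi> (u - v)) * (chi (u - v) x * cnj (chi (u - v) y))))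
    (\<Sum>u\<in>F. \<Sum>v\<in>F. of_real (\<Phi> (u - v)) * (chi (u - v) x * fourier_coeff m f (chi (u - v))))"
proof -
  have "has_bochner_integral m (\<lambda>y. of_real (\<Phi> (u - v)) * (chi (u - v) x * (f y * cnj (chi (u - v) y))))
      (of_real (\<Phi> (u - v)) * (chi (u - v) x * fourier_coeff m f (chi (u - v))))"
    if "u \<in> F" "v \<in> F" for u v
    unfolding fourier_coeff_def using that assms diff_freqs
    by (intro has_bochner_integral_mult_right has_bochner_integral_integrable
        integrable_mult_cnj_character chi_character) auto
  then have "has_bochner_integral m
      (\<lambda>y. \<Sum>u\<in>F. \<Sum>v\<in>F. of_real (\<Phi> (u - v)) * (chi (u - v) x * (f y * cnj (chi (u - v) y))))
      (\<Sum>u\<in>F. \<Sum>v\<in>F. of_real (\<Phi> (u - v)) * (chi (u - v) x * fourier_coeff m f (chi (u - v))))"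
    by (intro has_bochner_integral_sum) auto
  then show ?thesis
    by (simp add: sum_distrib_left mult_ac)
qed

lemma has_bochner_integral_norm_kernel:
  fixes f :: "'a \<Rightarrow> complex" and \<Psi> :: "real \<Rightarrow> real"
  assumes "finite F" "F \<subseteq> freqs" "integrable m f" "x \<in> carrier G"
  shows "has_bochner_integral m (\<lambda>y. norm (f y) * majorant_kernel \<Psi> F x y)
    (Re (\<Sum>u\<in>F. \<Sum>v\<in>F. of_real (\<Psi> (u - v)) *
      (chi (u - v) x * fourier_coeff m (\<lambda>y. of_real (norm (f y))) (chi (u - v)))))"
proof -
  have "integrable m (\<lambda>y. complex_of_real (norm (f y)))"
    using assms(3) by (simp add: integrable_norm)
  from has_bochner_integral_Re[OF has_bochner_integral_kernel[OF assms(1,2) this assms(4), of \<Psi>]]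
  show ?thesis
    by (simp add: majorant_kernel_def)
qed

text \<open>
  The sum on the left is the convolution of \<open>f\<close> with the kernel of \<open>\<Phi>\<close>, written out as a
  trigonometric polynomial.
\<close>

lemma fourier_sum_le_kernel:
  assumes "majorized \<Phi> \<Psi>" "finite F" "F \<subseteq> freqs" "integrable m f" "x \<in> carrier G"
  shows "norm (\<Sum>u\<in>F. \<Sum>v\<in>F. of_real (\<Phi> (u - v)) * (chi (u - v) x * fourier_coeff m f (chi (u - v))))
    \<le> (\<integral>y. norm (f y) * majorant_kernel \<Psi> F x y \<partial>m)"
proof -
  note Q = has_bochner_integral_kernel[OF assms(2-5), of \<Phi>]
  show ?thesis
    unfolding has_bochner_integral_integral_eq[OF Q, symmetric]
  proof (rule norm_integral_le_integral)
    show "integrable m (\<lambda>y. norm (f y) * majorant_kernel \<Psi> F x y)"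
      using has_bochner_integral_norm_kernel[OF assms(2-5)] by (simp add: has_bochner_integral_iff)
  qed (use Q norm_kernel_sum_le[OF assms(1-3,5)] in
      \<open>auto simp: has_bochner_integral_iff norm_mult intro!: mult_left_mono\<close>)
qed

lemma kernel_nonneg:
  assumes "majorized \<Phi> \<Psi>" "finite F" "F \<subseteq> freqs" "x \<in> carrier G" "y \<in> carrier G"
  shows "0 \<le> majorant_kernel \<Psi> F x y"
  by (rule order_trans[OF norm_ge_zero norm_kernel_sum_le[OF assms]])

text \<open>
  Of all the terms of the kernel, orthogonality keeps those with \<open>u = v\<close>. This and
  \<open>has_bochner_integral_kernel_average\<close> are the two halves of Young's inequality, for the
  exponents \<open>\<infinity>\<close> and \<open>1\<close>.
\<close>

lemma has_bochner_integral_kernel_right: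
  fixes \<Psi> :: "real \<Rightarrow> real"
  assumes "finite F" "F \<subseteq> freqs" "x \<in> carrier G"
  shows "has_bochner_integral m (majorant_kernel \<Psi> F x) (card F * \<Psi> 0)"
proof -
  have "fourier_coeff m (\<lambda>_. 1) (chi (u - v)) = (if u - v = 0 then 1 else 0)" if "u \<in> F" "v \<in> F" for u v
  proof -
    have "u - v \<in> freqs"
      using that assms(2) diff_freqs by blast
    moreover have "fourier_coeff m (\<lambda>_. 1) (chi (u - v)) = cnj (\<integral>y. chi (u - v) y \<partial>m)"
      by (simp add: fourier_coeff_def)
    ultimately show ?thesis
      by (simp add: integral_chi)
  qed
  then have "(\<Sum>u\<in>F. \<Sum>v\<in>F. of_real (\<Psi> (u - v)) * (chi (u - v) x * fourier_coeff m (\<lambda>_. 1) (chi (u - v))))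
      = (\<Sum>u\<in>F. \<Sum>v\<in>F. if u - v = 0 then complex_of_real (\<Psi> 0) else 0)"
    by (intro sum.cong refl) (simp add: chi_zero assms(3))
  also have "\<dots> = of_real (card F * \<Psi> 0)"
    using assms(1) by (simp add: sum_diagonal)
  finally show ?thesis
    using has_bochner_integral_Re[OF has_bochner_integral_kernel[OF assms(1,2) _ assms(3), of "\<lambda>_. 1" \<Psi>]]
    by (simp add: majorant_kernel_def[abs_def])
qed

text \<open>
  The inner integral is a trigonometric polynomial in \<open>x\<close>, so its integral is its constant
  coefficient.
\<close>

lemma has_bochner_integral_kernel_average:
  fixes f :: "'a \<Rightarrow> complex" and \<Psi> :: "real \<Rightarrow> real"
  assumes "finite F" "F \<subseteq> freqs" "integrable m f"
  shows "has_bochner_integral m (\<lambda>x. \<integral>y. norm (f y) * majorant_kernel \<Psi> F x y \<partial>m)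
    (card F * \<Psi> 0 * (\<integral>y. norm (f y) \<partial>m))"
proof -
  define c where "c d = fourier_coeff m (\<lambda>y. of_real (norm (f y))) (chi d)" for d
  have inner: "(\<integral>y. norm (f y) * majorant_kernel \<Psi> F x y \<partial>m)
      = Re (\<Sum>u\<in>F. \<Sum>v\<in>F. of_real (\<Psi> (u - v)) * (chi (u - v) x * c (u - v)))"
    if "x \<in> space m" for x
    unfolding c_def using that
    by (intro has_bochner_integral_integral_eq has_bochner_integral_norm_kernel assms) simp
  have "has_bochner_integral m (\<lambda>x. of_real (\<Psi> (u - v)) * (chi (u - v) x * c (u - v)))
      (if u - v = 0 then of_real (\<Psi> 0) * c 0 else 0)" if "u \<in> F" "v \<in> F" for u v
  proof -
    have d: "u - v \<in> freqs"
      using that assms(2) diff_freqs by blast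
    have "has_bochner_integral m (chi (u - v)) (if u - v = 0 then 1 else 0)"
      using integrable_character[OF chi_character[OF d]] integral_chi[OF d]
      by (simp add: has_bochner_integral_iff)
    then have "has_bochner_integral m (\<lambda>x. of_real (\<Psi> (u - v)) * (chi (u - v) x * c (u - v)))
        (of_real (\<Psi> (u - v)) * ((if u - v = 0 then 1 else 0) * c (u - v)))"
      by (intro has_bochner_integral_mult_right has_bochner_integral_mult_left)
    then show ?thesis
      by (auto split: if_splits)
  qed
  then have "has_bochner_integral m
      (\<lambda>x. \<Sum>u\<in>F. \<Sum>v\<in>F. of_real (\<Psi> (u - v)) * (chi (u - v) x * c (u - v)))
      (\<Sum>u\<in>F. \<Sum>v\<in>F. if u - v = 0 then of_real (\<Psi> 0) * c 0 else 0)"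
    by (intro has_bochner_integral_sum)
  from has_bochner_integral_Re[OF this]
  have "has_bochner_integral m
      (\<lambda>x. Re (\<Sum>u\<in>F. \<Sum>v\<in>F. of_real (\<Psi> (u - v)) * (chi (u - v) x * c (u - v))))
      (card F * \<Psi> 0 * Re (c 0))"
    using assms(1) by (simp only: sum_diagonal) (simp add: mult.assoc)
  moreover have "c 0 = of_real (\<integral>y. norm (f y) \<partial>m)"
  proof -
    have "c 0 = (\<integral>y. complex_of_real (norm (f y)) \<partial>m)"
      unfolding c_def fourier_coeff_def
      by (intro Bochner_Integration.integral_cong) (auto simp: chi_zero)
    then show ?thesis by simp
  qed
  ultimately have "has_bochner_integral m
      (\<lambda>x. Re (\<Sum>u\<in>F. \<Sum>v\<in>F. of_real (\<Psi> (u - v)) * (chi (u - v) x * c (u - v))))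
      (card F * \<Psi> 0 * (\<integral>y. norm (f y) \<partial>m))"
    by simp
  then show ?thesis
    by (subst has_bochner_integral_cong[OF refl inner refl])
qed

end

section \<open>Lebesgue norms\<close>

lemma Lp_norm_nonneg: "0 \<le> Lp_norm p m f"
  by (simp add: Lp_norm_def)

lemma Lp_norm_1: "Lp_norm 1 m f = (\<integral>x. norm (f x) \<partial>m)"
  by (simp add: Lp_norm_def)

lemma Hp_norm_le_Lp_norm:
  assumes "f \<in> Hp_functions lam G T \<beta> m p a"
  shows "Hp_norm lam G T \<beta> m p a \<le> Lp_norm p m f"
  unfolding Hp_norm_def using assms
  by (intro cINF_lower bdd_belowI2[of _ 0]) (auto simp: Lp_norm_nonneg)

context haar_dirichlet_group
begin

lemma AE_norm_le_Lp_norm: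
  assumes "f \<in> Lp_space \<infinity> m"
  shows "AE x in m. norm (f x) \<le> Lp_norm \<infinity> m f"
proof -
  let ?E = "esssup m (\<lambda>x. ennreal (norm (f x)))"
  have "?E < \<infinity>"
    using assms by (simp add: Lp_space_def)
  then have "?E = ennreal (Lp_norm \<infinity> m f)"
    by (simp add: Lp_norm_def ennreal_enn2real)
  then have "AE x in m. ennreal (norm (f x)) \<le> ennreal (Lp_norm \<infinity> m f)"
    using esssup_AE[where M = m and f = "\<lambda>x. ennreal (norm (f x))"] by simp
  then show ?thesis
    by (simp add: ennreal_le_iff Lp_norm_nonneg)
qed

lemma Lp_space_integrable:
  assumes "p \<in> {1, \<infinity>}" "f \<in> Lp_space p m"
  shows "integrable m f"
proof (cases "p = \<infinity>")
  case True
  then show ?thesis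
    using AE_norm_le_Lp_norm[of f] assms(2)
    by (intro integrable_const_bound[where B = "Lp_norm \<infinity> m f"]) (auto simp: Lp_space_def)
next
  case False
  then show ?thesis
    using assms by (auto simp: Lp_space_def integrable_norm_iff)
qed

lemma bounded_Lp_space:
  assumes "p \<in> {1, \<infinity>}" "f \<in> borel_measurable m" "\<And>x. x \<in> carrier G \<Longrightarrow> norm (f x) \<le> B"
  shows "f \<in> Lp_space p m"
proof (cases "p = \<infinity>")
  case True
  have "AE x in m. ennreal (norm (f x)) \<le> ennreal B"
    using assms(3) by (intro AE_I2) (auto intro: ennreal_leI)
  then have "esssup m (\<lambda>x. ennreal (norm (f x))) \<le> ennreal B"
    using assms(2) by (intro esssup_I) auto
  also have "\<dots> < \<infinity>"
    by simp
  finally show ?thesis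
    using True assms(2) by (simp add: Lp_space_def)
next
  case False
  have "integrable m f"
    using assms(2,3) by (intro integrable_const_bound[where B = B] AE_I2) auto
  then show ?thesis
    using False assms(1,2) by (auto simp: Lp_space_def)
qed

text \<open>
  The additive constant \<open>c\<close> leaves room for the error that arises because a finite set of
  frequencies is only almost invariant.
\<close>

lemma Lp_norm_le_kernel_average:
  fixes f g :: "'a \<Rightarrow> complex"
  assumes p: "p \<in> {1, \<infinity>}" and f: "f \<in> Lp_space p m" and g: "g \<in> borel_measurable m"
    and maj: "majorized \<Phi> \<Psi>" and F: "finite F" "F \<noteq> {}" "F \<subseteq> freqs"
    and c: "0 \<le> c"
    and le: "\<And>x. x \<in> carrier G \<Longrightarrow>
      norm (g x) \<le> c + (\<integral>y. norm (f y) * majorant_kernel \<Psi> F x y \<partial>m) / card F"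
  shows "Lp_norm p m g \<le> c + \<Psi> 0 * Lp_norm p m f"
proof (cases "p = \<infinity>")
  case True
  define M where "M = Lp_norm \<infinity> m f"
  have int_f: "integrable m f"
    using Lp_space_integrable[OF p f] .
  have "norm (g x) \<le> c + \<Psi> 0 * M" if x: "x \<in> carrier G" for x
  proof -
    have K: "has_bochner_integral m (majorant_kernel \<Psi> F x) (card F * \<Psi> 0)"
      by (rule has_bochner_integral_kernel_right[OF F(1,3) x])
    have "(\<integral>y. norm (f y) * majorant_kernel \<Psi> F x y \<partial>m) \<le> (\<integral>y. M * majorant_kernel \<Psi> F x y \<partial>m)"
    proof (rule integral_mono_AE)
      show "integrable m (\<lambda>y. norm (f y) * majorant_kernel \<Psi> F x y)"
        using has_bochner_integral_norm_kernel[OF F(1,3) int_f x]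
        by (simp add: has_bochner_integral_iff)
      show "integrable m (\<lambda>y. M * majorant_kernel \<Psi> F x y)"
        using K by (simp add: has_bochner_integral_iff)
      have "AE y in m. norm (f y) \<le> M"
        using f True AE_norm_le_Lp_norm by (simp add: M_def)
      moreover have "AE y in m. 0 \<le> majorant_kernel \<Psi> F x y"
        using kernel_nonneg[OF maj F(1,3) x] by (intro AE_I2) simp
      ultimately show "AE y in m. norm (f y) * majorant_kernel \<Psi> F x y \<le> M * majorant_kernel \<Psi> F x y"
        by eventually_elim (rule mult_right_mono)
    qed
    also have "\<dots> = card F * (\<Psi> 0 * M)"
      using K by (simp add: has_bochner_integral_iff)
    finally have "(\<integral>y. norm (f y) * majorant_kernel \<Psi> F x y \<partial>m) / card F \<le> \<Psi> 0 * M"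
      using F by (simp add: divide_le_eq card_gt_0_iff mult.commute)
    with le[OF x] show ?thesis by simp
  qed
  then have "AE x in m. ennreal (norm (g x)) \<le> ennreal (c + \<Psi> 0 * M)"
    by (intro AE_I2 ennreal_leI) simp
  then have "esssup m (\<lambda>x. ennreal (norm (g x))) \<le> ennreal (c + \<Psi> 0 * M)"
    using g by (intro esssup_I) auto
  then have "enn2real (esssup m (\<lambda>x. ennreal (norm (g x)))) \<le> enn2real (ennreal (c + \<Psi> 0 * M))"
    by (rule enn2real_mono) simp
  moreover have "0 \<le> c + \<Psi> 0 * M"
    using \<open>\<And>x. x \<in> carrier G \<Longrightarrow> norm (g x) \<le> c + \<Psi> 0 * M\<close>[OF one_closed] norm_ge_zero order_trans
    by blast
  ultimately show ?thesis
    using True by (simp add: Lp_norm_def M_def)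
next
  case False
  then have "p = 1" using p by simp
  have "integrable m f"
    using Lp_space_integrable[OF p f] .
  from has_bochner_integral_kernel_average[OF F(1,3) this, of \<Psi>]
  have avg: "integrable m (\<lambda>x. \<integral>y. norm (f y) * majorant_kernel \<Psi> F x y \<partial>m)"
    "(\<integral>x. (\<integral>y. norm (f y) * majorant_kernel \<Psi> F x y \<partial>m) \<partial>m) = card F * \<Psi> 0 * (\<integral>y. norm (f y) \<partial>m)"
    by (auto simp: has_bochner_integral_iff)
  have "(\<integral>x. norm (g x) \<partial>m)
      \<le> (\<integral>x. c + (\<integral>y. norm (f y) * majorant_kernel \<Psi> F x y \<partial>m) / card F \<partial>m)"
    using avg(1) order_trans[OF norm_ge_zero le] by (intro Bochner_Integration.integral_mono'[OF _ le]) auto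
  also have "\<dots> = c + card F * \<Psi> 0 * (\<integral>y. norm (f y) \<partial>m) / card F"
    using avg prob_space by simp
  also have "\<dots> = c + \<Psi> 0 * (\<integral>y. norm (f y) \<partial>m)"
    using F by simp
  finally show ?thesis
    by (simp add: \<open>p = 1\<close> Lp_norm_1)
qed

text \<open>
  The polynomial is a function in the Hardy space with the coefficients of the partial sum, so the
  norm of the partial sum is at most the norm of the polynomial.
\<close>

lemma trig_polynomial_Hp_functions:
  assumes "p \<in> {1, \<infinity>}" "strict_mono lam" "range lam \<subseteq> freqs"
  shows "(\<lambda>x. \<Sum>n\<le>N. a n * chi (lam n) x) \<in> Hp_functions lam G T \<beta> m p (partial_sum N a)"
    (is "?P \<in> _")
proof -
  have lam: "lam n \<in> freqs" for n
    using assms(3) by auto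
  have meas: "?P \<in> borel_measurable m"
    by (intro borel_measurable_sum borel_measurable_times borel_measurable_const character_measurable
        chi_character lam)
  have "norm (?P x) \<le> (\<Sum>n\<le>N. norm (a n))" if "x \<in> carrier G" for x
    using that lam by (intro sum_norm_le) (simp add: norm_mult chi_character)
  with assms(1) meas have Lp: "?P \<in> Lp_space p m"
    by (rule bounded_Lp_space)
  have coeff: "fourier_coeff m ?P \<gamma> = (\<Sum>n\<le>N. if chi (lam n) = \<gamma> then a n else 0)"
    if \<gamma>: "\<gamma> \<in> characters G T" for \<gamma>
  proof -
    have "fourier_coeff m ?P \<gamma> = (\<integral>x. (\<Sum>n\<le>N. a n * (chi (lam n) x * cnj (\<gamma> x))) \<partial>m)"
      by (simp add: fourier_coeff_def sum_distrib_right mult.assoc)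
    also have "\<dots> = (\<Sum>n\<le>N. a n * (\<integral>x. chi (lam n) x * cnj (\<gamma> x) \<partial>m))"
      using integrable_mult_cnj_character[OF integrable_character[OF chi_character[OF lam]] \<gamma>]
      by (subst Bochner_Integration.integral_sum) auto
    also have "\<dots> = (\<Sum>n\<le>N. if chi (lam n) = \<gamma> then a n else 0)"
      by (intro sum.cong) (auto simp: characters_orthonormal[OF chi_character[OF lam] \<gamma>])
    finally show ?thesis .
  qed
  have "chi (lam n) = chi (lam k) \<longleftrightarrow> n = k" for n k
    using chi_inject[OF lam lam] assms(2) by (auto simp: strict_mono_eq)
  then have "fourier_coeff m ?P (chi (lam k)) = partial_sum N a k" for k
    by (simp add: coeff[OF chi_character[OF lam]] partial_sum_def)
  moreover have "\<exists>n. \<gamma> = chi (lam n)" if "\<gamma> \<in> characters G T" "fourier_coeff m ?P \<gamma> \<noteq> 0" for \<gamma>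
  proof (rule ccontr)
    assume "\<nexists>n. \<gamma> = chi (lam n)"
    then have "chi (lam n) \<noteq> \<gamma>" for n by metis
    then show False
      using that coeff by simp
  qed
  ultimately show ?thesis
    using Lp by (simp add: Hp_functions_def Hp_group_def)
qed

text \<open>
  The coefficients of \<open>f\<close> vanish off \<open>range lam\<close>, so the values of \<open>\<Phi>\<close> matter at the points
  \<open>lam n\<close> alone, where they cut off the series after \<open>N\<close>.
\<close>

lemma fourier_sum_eq_partial_sum:
  assumes "strict_mono lam" "range lam \<subseteq> freqs" "finite F" "F \<subseteq> freqs"
    and f: "f \<in> Hp_functions lam G T \<beta> m p a"
    and one: "\<And>n. n \<le> N \<Longrightarrow> \<Phi> (lam n) = 1" and zero: "\<And>n. N < n \<Longrightarrow> \<Phi> (lam n) = 0"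
  shows "(\<Sum>u\<in>F. \<Sum>v\<in>F. of_real (\<Phi> (u - v)) * (chi (u - v) x * fourier_coeff m f (chi (u - v))))
    = (\<Sum>n\<le>N. of_nat (card {v\<in>F. v + lam n \<in> F}) * (a n * chi (lam n) x))"
proof -
  have lam: "lam n \<in> freqs" for n
    using assms(2) by auto
  have coeff: "fourier_coeff m f (chi (lam n)) = a n" for n
    using f by (simp add: Hp_functions_def)
  have "of_real (\<Phi> d) * (chi d x * fourier_coeff m f (chi d))
      = (\<Sum>n\<le>N. if d = lam n then a n * chi (lam n) x else 0)" if d: "d \<in> freqs" for d
  proof (cases "d \<in> range lam")
    case True
    then obtain k where k: "d = lam k" by auto
    have "(\<Sum>n\<le>N. if d = lam n then a n * chi (lam n) x else 0)
        = (\<Sum>n\<le>N. if k = n then a n * chi (lam n) x else 0)"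
      using assms(1) by (intro sum.cong) (auto simp: k strict_mono_eq)
    then show ?thesis
      using one[of k] zero[of k] by (auto simp: k coeff)
  next
    case False
    then have "chi d \<noteq> chi (lam n)" for n
      using chi_inject[OF d lam] by blast
    then have "fourier_coeff m f (chi d) = 0"
      using f chi_character[OF d] by (auto simp: Hp_functions_def Hp_group_def)
    moreover have "(\<Sum>n\<le>N. if d = lam n then a n * chi (lam n) x else 0) = 0"
      using False by (intro sum.neutral) auto
    ultimately show ?thesis by simp
  qed
  then have "(\<Sum>u\<in>F. \<Sum>v\<in>F. of_real (\<Phi> (u - v)) * (chi (u - v) x * fourier_coeff m f (chi (u - v))))
      = (\<Sum>u\<in>F. \<Sum>v\<in>F. \<Sum>n\<le>N. if u - v = lam n then a n * chi (lam n) x else 0)"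
    using assms(4) diff_freqs by (intro sum.cong refl) blast
  also have "\<dots> = (\<Sum>u\<in>F. \<Sum>n\<le>N. \<Sum>v\<in>F. if u - v = lam n then a n * chi (lam n) x else 0)"
    by (intro sum.cong refl sum.swap)
  also have "\<dots> = (\<Sum>n\<le>N. \<Sum>u\<in>F. \<Sum>v\<in>F. if u - v = lam n then a n * chi (lam n) x else 0)"
    by (rule sum.swap)
  finally show ?thesis
    using assms(3) by (simp add: sum_over_differences)
qed

text \<open>
  Divided by \<open>card F\<close>, the convolution of \<open>f\<close> with the kernel of \<open>\<Phi>\<close> differs from the partial
  sum by factors \<open>\<rho> n\<close> between \<open>1 - \<epsilon>\<close> and \<open>1\<close>, hence uniformly by at most \<open>\<epsilon> * (\<Sum>n\<le>N. norm (a n))\<close>.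
\<close>

lemma Lp_norm_partial_sum_le:
  assumes p: "p \<in> {1, \<infinity>}" and lam: "strict_mono lam" "range lam \<subseteq> freqs"
    and f: "f \<in> Hp_functions lam G T \<beta> m p a" and maj: "majorized \<Phi> \<Psi>"
    and one: "\<And>n. n \<le> N \<Longrightarrow> \<Phi> (lam n) = 1" and zero: "\<And>n. N < n \<Longrightarrow> \<Phi> (lam n) = 0"
  shows "Lp_norm p m (\<lambda>x. \<Sum>n\<le>N. a n * chi (lam n) x) \<le> \<Psi> 0 * Lp_norm p m f"
    (is "Lp_norm p m ?P \<le> _")
proof (rule field_le_epsilon)
  fix e :: real assume "0 < e"
  define S where "S = (\<Sum>n\<le>N. norm (a n))"
  have "0 \<le> S" by (simp add: S_def sum_nonneg)
  \<comment> \<open>Adding \<open>1\<close> avoids a division by zero if all the \<open>a n\<close> vanish.\<close>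
  define \<epsilon> where "\<epsilon> = e / (S + 1)"
  have "0 < \<epsilon>" using \<open>0 < e\<close> \<open>0 \<le> S\<close> by (simp add: \<epsilon>_def)
  obtain F where F: "finite F" "F \<noteq> {}" "F \<subseteq> freqs"
    and inv: "\<And>d. d \<in> lam ` {..N} \<Longrightarrow> (1 - \<epsilon>) * real (card F) \<le> real (card {v\<in>F. v + d \<in> F})"
    using ex_almost_invariant_set[of "lam ` {..N}" freqs \<epsilon>] lam(2) zero_freqs add_freqs \<open>0 < \<epsilon>\<close>
    by (auto simp: image_subset_iff)
  have "0 < card F" using F by (simp add: card_gt_0_iff)
  have f_Lp: "f \<in> Lp_space p m"
    using f by (simp add: Hp_functions_def Hp_group_def)
  have "Lp_norm p m ?P \<le> \<epsilon> * S + \<Psi> 0 * Lp_norm p m f"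
  proof (rule Lp_norm_le_kernel_average[OF p f_Lp _ maj F])
    show "?P \<in> borel_measurable m"
      using lam(2) by (intro borel_measurable_sum borel_measurable_times borel_measurable_const
          character_measurable chi_character) auto
    show "0 \<le> \<epsilon> * S"
      using \<open>0 < \<epsilon>\<close> \<open>0 \<le> S\<close> by simp
    fix x assume x: "x \<in> carrier G"
    define \<rho> where "\<rho> n = real (card {v\<in>F. v + lam n \<in> F}) / card F" for n
    have \<rho>: "\<bar>1 - \<rho> n\<bar> \<le> \<epsilon>" if "n \<le> N" for n
    proof -
      have "1 - \<epsilon> \<le> \<rho> n"
        using inv[of "lam n"] that \<open>0 < card F\<close> by (simp add: \<rho>_def le_divide_eq)
      moreover have "card {v\<in>F. v + lam n \<in> F} \<le> card F"
        using F(1) by (intro card_mono) auto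
      then have "\<rho> n \<le> 1"
        using \<open>0 < card F\<close> by (simp add: \<rho>_def)
      ultimately show ?thesis by linarith
    qed
    let ?Q = "\<Sum>u\<in>F. \<Sum>v\<in>F. of_real (\<Phi> (u - v)) * (chi (u - v) x * fourier_coeff m f (chi (u - v)))"
    have "?Q = (\<Sum>n\<le>N. of_nat (card {v\<in>F. v + lam n \<in> F}) * (a n * chi (lam n) x))"
      using lam F(1,3) f one zero by (rule fourier_sum_eq_partial_sum)
    then have Q: "?Q / card F = (\<Sum>n\<le>N. of_real (\<rho> n) * (a n * chi (lam n) x))"
      by (simp only: sum_divide_distrib) (simp add: \<rho>_def)
    have "?P x - ?Q / card F = (\<Sum>n\<le>N. of_real (1 - \<rho> n) * (a n * chi (lam n) x))"
      unfolding Q by (simp add: algebra_simps flip: sum_subtractf)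
    also have "norm \<dots> \<le> (\<Sum>n\<le>N. \<epsilon> * norm (a n))"
    proof (rule sum_norm_le)
      fix n assume "n \<in> {..N}"
      moreover have "norm (chi (lam n) x) = 1"
        using lam(2) x by (intro norm_character chi_character) auto
      ultimately show "norm (of_real (1 - \<rho> n) * (a n * chi (lam n) x)) \<le> \<epsilon> * norm (a n)"
        using \<rho>[of n] by (simp only: norm_mult norm_of_real) (simp add: mult_right_mono)
    qed
    also have "\<dots> = \<epsilon> * S"
      by (simp add: S_def sum_distrib_left)
    finally have "norm (?P x - ?Q / card F) \<le> \<epsilon> * S" .
    moreover have "norm (?Q / card F) \<le> (\<integral>y. norm (f y) * majorant_kernel \<Psi> F x y \<partial>m) / card F"
      using fourier_sum_le_kernel[OF maj F(1,3) Lp_space_integrable[OF p f_Lp] x]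
      by (simp add: norm_divide divide_right_mono)
    ultimately show "norm (?P x) \<le> \<epsilon> * S + (\<integral>y. norm (f y) * majorant_kernel \<Psi> F x y \<partial>m) / card F"
      using norm_triangle_sub[of "?P x" "?Q / card F"] by linarith
  qed
  also have "\<epsilon> * S \<le> e"
    using \<open>0 < e\<close> \<open>0 \<le> S\<close> by (simp add: \<epsilon>_def field_simps)
  finally show "Lp_norm p m ?P \<le> \<Psi> 0 * Lp_norm p m f + e"
    by simp
qed

lemma Hp_opnorm_partial_sum_le:
  assumes "p \<in> {1, \<infinity>}" "strict_mono lam" "range lam \<subseteq> freqs" "majorized \<Phi> \<Psi>" "0 < \<Psi> 0"
    and "\<And>n. n \<le> N \<Longrightarrow> \<Phi> (lam n) = 1" "\<And>n. N < n \<Longrightarrow> \<Phi> (lam n) = 0"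
  shows "Hp_opnorm lam G T \<beta> m p (partial_sum N) \<le> ereal (\<Psi> 0)"
  unfolding Hp_opnorm_def
proof (rule SUP_least, clarify)
  fix a assume a: "a \<in> Hp_dirichlet lam G T \<beta> m p" and le1: "Hp_norm lam G T \<beta> m p a \<le> 1"
  let ?P = "\<lambda>x. \<Sum>n\<le>N. a n * chi (lam n) x"
  have "Hp_norm lam G T \<beta> m p (partial_sum N a) / \<Psi> 0 \<le> Hp_norm lam G T \<beta> m p a"
    unfolding Hp_norm_def[of _ _ _ _ _ _ a]
  proof (rule cINF_greatest)
    show "Hp_functions lam G T \<beta> m p a \<noteq> {}"
      using a by (simp add: Hp_dirichlet_def)
    fix f assume f: "f \<in> Hp_functions lam G T \<beta> m p a"
    have "Hp_norm lam G T \<beta> m p (partial_sum N a) \<le> Lp_norm p m ?P"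
      using assms by (intro Hp_norm_le_Lp_norm trig_polynomial_Hp_functions)
    also have "\<dots> \<le> \<Psi> 0 * Lp_norm p m f"
      using assms f by (intro Lp_norm_partial_sum_le)
    finally show "Hp_norm lam G T \<beta> m p (partial_sum N a) / \<Psi> 0 \<le> Lp_norm p m f"
      using assms(5) by (simp add: divide_le_eq mult.commute)
  qed
  also note le1
  finally show "ereal (Hp_norm lam G T \<beta> m p (partial_sum N a)) \<le> ereal (\<Psi> 0)"
    using assms(5) by simp
qed

end

section \<open>Gaps and operator norms\<close>

lemma ex_dyadic_scale:
  assumes "1 \<le> (z :: real)"
  obtains J :: nat where "z \<le> 2 ^ J" "real J / 2 + 1 \<le> ln z + 2"
proof
  define J where "J = nat \<lceil>log 2 z\<rceil>"
  have log: "0 \<le> log 2 z" using assms by simp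
  then have J: "log 2 z \<le> J" "J \<le> log 2 z + 1"
    unfolding J_def by linarith+
  have "z = 2 powr (log 2 z)" using assms by simp
  also have "\<dots> \<le> 2 powr J" using J by simp
  finally show "z \<le> 2 ^ J" by (simp add: powr_realpow)
  \<comment> \<open>The factor \<open>1/2\<close> of the number of triangles is at most \<open>ln 2\<close>, so \<open>log 2 z / 2 \<le> ln z\<close>.\<close>
  have "1/2 * ln z \<le> ln 2 * ln z"
    using assms ln2_ge_two_thirds by (intro mult_right_mono) auto
  then have "log 2 z / 2 \<le> ln z"
    by (simp add: log_def field_simps)
  with J show "real J / 2 + 1 \<le> ln z + 2" by linarith
qed

lemma partial_sum_closed:
  assumes "frequency lam" "p \<in> {1, \<infinity>}" "lambda_dirichlet_group lam G T \<beta>" "normalized_haar_measure G T m"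
    and "a \<in> Hp_dirichlet lam G T \<beta> m p"
  shows "partial_sum N a \<in> Hp_dirichlet lam G T \<beta> m p"
proof -
  interpret dirichlet_group G T \<beta>
    using assms(3) by (simp add: lambda_dirichlet_group_def)
  interpret haar_dirichlet_group G T \<beta> m
    by unfold_locales (rule assms(4))
  have "range lam \<subseteq> freqs"
    using assms(3) by (auto simp: lambda_dirichlet_group_def freqs_def)
  moreover have "strict_mono lam"
    using assms(1) by (simp add: frequency_def)
  ultimately show ?thesis
    using trig_polynomial_Hp_functions[OF assms(2), of lam a N] by (auto simp: Hp_dirichlet_def)
qed

text \<open>
  The multiplier has to fall from \<open>1\<close> to \<open>0\<close> between \<open>lam N\<close> and \<open>lam (Suc N)\<close>. Any lower bound
  \<open>d\<close> of this gap may be used, in particular the ones that the conditions of Bohr and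
  Landau provide.
\<close>

lemma Hp_opnorm_partial_sum_gap:
  assumes "frequency lam" "p \<in> {1, \<infinity>}" "lambda_dirichlet_group lam G T \<beta>" "normalized_haar_measure G T m"
    and gap: "0 < d" "d \<le> lam (Suc N) - lam N"
  shows "Hp_opnorm lam G T \<beta> m p (partial_sum N) \<le> ereal (ln (1 + lam N / d) + 2)"
proof -
  interpret dirichlet_group G T \<beta>
    using assms(3) by (simp add: lambda_dirichlet_group_def)
  interpret haar_dirichlet_group G T \<beta> m
    by unfold_locales (rule assms(4))
  have lam: "strict_mono lam" "range lam \<subseteq> freqs" "\<And>n. 0 \<le> lam n"
    using assms(1,3) by (auto simp: frequency_def lambda_dirichlet_group_def freqs_def)
  obtain J where J: "1 + lam N / d \<le> 2 ^ J" "real J / 2 + 1 \<le> ln (1 + lam N / d) + 2"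
    using ex_dyadic_scale[of "1 + lam N / d"] lam(3)[of N] gap(1) by auto
  have "lam N + d \<le> 2 ^ J * d"
    using J(1) gap(1) by (simp add: field_simps)
  then obtain \<Phi> \<Psi> where \<Phi>: "majorized \<Phi> \<Psi>" "\<Psi> 0 = real J / 2 + 1"
    "\<And>x. 0 \<le> x \<Longrightarrow> x \<le> lam N \<Longrightarrow> \<Phi> x = 1" "\<And>x. lam N + d \<le> x \<Longrightarrow> \<Phi> x = 0"
    using ex_step_multiplier[OF gap(1)] by metis
  have "\<Phi> (lam n) = 0" if "N < n" for n
  proof (rule \<Phi>(4))
    have "lam (Suc N) \<le> lam n"
      using lam(1) that by (simp add: strict_mono_less_eq)
    then show "lam N + d \<le> lam n"
      using gap(2) by linarith
  qed
  then have "Hp_opnorm lam G T \<beta> m p (partial_sum N) \<le> ereal (\<Psi> 0)"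
    using assms(2) lam \<Phi> by (intro Hp_opnorm_partial_sum_le[of _ _ \<Phi>]) (auto simp: strict_mono_less_eq)
  also have "\<dots> \<le> ereal (ln (1 + lam N / d) + 2)"
    using J(2) \<Phi>(2) by simp
  finally show ?thesis .
qed

text \<open>
  Both conditions bound the gap below by an expression \<open>c * exp (- r)\<close>, with \<open>r\<close> linear in
  \<open>lam N\<close> or exponential in it.
\<close>

lemma ln_ratio_le:
  assumes "0 \<le> x" "0 < c" "0 \<le> (r::real)"
  shows "ln (1 + x / (c * exp (- r))) \<le> x + r + \<bar>ln c\<bar>"
proof -
  define c' where "c' = min c 1"
  have c': "0 < c'" "c' \<le> c" "c' \<le> 1" using assms(2) by (auto simp: c'_def)
  have "1 \<le> exp r / c'"
    using c' assms(3) by (simp add: le_divide_eq order_trans[OF c'(3)])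
  have "1 + x / (c * exp (- r)) = 1 + x * (exp r / c)"
    by (simp add: exp_minus field_simps)
  also have "\<dots> \<le> 1 + x * (exp r / c')"
    using assms c' by (intro add_left_mono mult_left_mono divide_left_mono) auto
  also have "\<dots> \<le> (1 + x) * (exp r / c')"
    using \<open>1 \<le> exp r / c'\<close> by (simp only: distrib_right)
  also have "\<dots> \<le> exp x * (exp r / c')"
    using c' by (intro mult_right_mono) auto
  finally have "ln (1 + x / (c * exp (- r))) \<le> ln (exp x * (exp r / c'))"
    using assms by (subst ln_le_cancel_iff) (auto intro!: add_pos_nonneg mult_pos_pos divide_pos_pos simp: c')
  also have "\<dots> = x + r - ln c'"
    using c' by (simp add: ln_mult ln_div)
  also have "- ln c' \<le> \<bar>ln c\<bar>"
    by (auto simp: c'_def min_def)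
  then have "x + r - ln c' \<le> x + r + \<bar>ln c\<bar>" by simp
  finally show ?thesis .
qed

text \<open>
  The logarithm is at most an affine function of \<open>lam N\<close>. The constant term is absorbed because
  \<open>lam N\<close> is bounded below by the least positive frequency \<open>\<mu>\<close>.
\<close>

lemma bohr_log_bound:
  assumes "frequency lam" "bohr_condition lam"
  obtains C where "\<And>N. 0 < lam N \<Longrightarrow>
    \<exists>d>0. d \<le> lam (Suc N) - lam N \<and> ln (1 + lam N / d) + 2 \<le> C * lam N"
proof -
  have mono: "strict_mono lam" and nonneg: "0 \<le> lam n" for n
    using assms(1) by (auto simp: frequency_def)
  obtain l c where l: "0 < l" and c: "0 < c"
    and gap: "\<And>n. c * exp (- (l + 1) * lam n) \<le> lam (Suc n) - lam n"
    using assms(2) unfolding bohr_condition_def by (meson zero_less_one)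
  define \<mu> where "\<mu> = (if lam 0 = 0 then lam 1 else lam 0)"
  have "0 < lam 1"
    using mono nonneg[of 0] by (metis le_less_trans strict_monoD zero_less_one)
  then have \<mu>: "0 < \<mu>"
    using nonneg[of 0] by (auto simp: \<mu>_def)
  have \<mu>_le: "\<mu> \<le> lam N" if "0 < lam N" for N
    using that mono by (cases N) (auto simp: \<mu>_def strict_mono_less_eq)
  define K where "K = \<bar>ln c\<bar> + 2"
  show thesis
  proof (rule that[of "l + 2 + K / \<mu>"])
    fix N assume pos: "0 < lam N"
    let ?d = "c * exp (- ((l + 1) * lam N))"
    have "ln (1 + lam N / ?d) + 2 \<le> lam N + (l + 1) * lam N + \<bar>ln c\<bar> + 2"
      using ln_ratio_le[of "lam N" c "(l + 1) * lam N"] pos c l by simp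
    also have "\<dots> = (l + 2) * lam N + K"
      by (simp add: K_def algebra_simps)
    also have "\<dots> = (l + 2) * lam N + K / \<mu> * \<mu>"
      using \<mu> by simp
    also have "\<dots> \<le> (l + 2) * lam N + K / \<mu> * lam N"
      using \<mu> \<mu>_le[OF pos] by (intro add_left_mono mult_left_mono) (auto simp: K_def)
    also have "\<dots> = (l + 2 + K / \<mu>) * lam N"
      by (simp add: algebra_simps)
    finally show "\<exists>d>0. d \<le> lam (Suc N) - lam N \<and> ln (1 + lam N / d) + 2 \<le> (l + 2 + K / \<mu>) * lam N"
      using gap[of N] c by (intro exI[of _ ?d]) (auto simp: algebra_simps)
  qed
qed

text \<open>
  With the gap bound \<open>c * exp (- exp (\<delta> * lam N))\<close>, the logarithm is at most
  \<open>lam N + exp (\<delta> * lam N)\<close> plus a constant, and the second term dominates the others.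
\<close>

lemma landau_log_bound:
  assumes "frequency lam" "landau_condition lam" "0 < \<delta>"
  obtains C where "\<And>N. \<exists>d>0. d \<le> lam (Suc N) - lam N \<and> ln (1 + lam N / d) + 2 \<le> C * exp (\<delta> * lam N)"
proof -
  have nonneg: "0 \<le> lam n" for n
    using assms(1) by (auto simp: frequency_def)
  obtain c where c: "0 < c" and gap: "\<And>n. c * exp (- exp (\<delta> * lam n)) \<le> lam (Suc n) - lam n"
    using assms(2,3) unfolding landau_condition_def by meson
  define K where "K = \<bar>ln c\<bar> + 2"
  show thesis
  proof (rule that[of "1 / \<delta> + 1 + K"])
    fix N
    let ?d = "c * exp (- exp (\<delta> * lam N))" and ?E = "exp (\<delta> * lam N)"
    have "\<delta> * lam N \<le> ?E"
      using exp_ge_add_one_self[of "\<delta> * lam N"] by linarith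
    then have "lam N \<le> 1 / \<delta> * ?E"
      using \<open>0 < \<delta>\<close> by (simp add: field_simps)
    moreover have "K * 1 \<le> K * ?E"
      using nonneg[of N] \<open>0 < \<delta>\<close> by (intro mult_left_mono) (auto simp: K_def)
    moreover have "ln (1 + lam N / ?d) + 2 \<le> lam N + ?E + K"
      using ln_ratio_le[of "lam N" c ?E] nonneg c by (simp add: K_def)
    ultimately have "ln (1 + lam N / ?d) + 2 \<le> (1 / \<delta> + 1 + K) * ?E"
      by (simp add: distrib_right)
    then show "\<exists>d>0. d \<le> lam (Suc N) - lam N \<and> ln (1 + lam N / d) + 2 \<le> (1 / \<delta> + 1 + K) * ?E"
      using gap[of N] c by (intro exI[of _ ?d]) auto
  qed
qed

theorem proposition4p17:
  fixes lam :: "nat \<Rightarrow> real"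
  assumes "frequency lam"
  shows
    "(\<forall>p\<in>{1, \<infinity>}. \<forall>(G :: 'a monoid) T \<beta> m.
        lambda_dirichlet_group lam G T \<beta> \<longrightarrow> normalized_haar_measure G T m \<longrightarrow>
        (\<forall>N. partial_sum N \<in> Hp_dirichlet lam G T \<beta> m p \<rightarrow> Hp_dirichlet lam G T \<beta> m p))
     \<and>
     (bohr_condition lam \<longrightarrow>
       (\<exists>C. \<forall>p\<in>{1, \<infinity>}. \<forall>(G :: 'a monoid) T \<beta> m.
          lambda_dirichlet_group lam G T \<beta> \<longrightarrow> normalized_haar_measure G T m \<longrightarrow>
          (\<forall>N. lam N > 0 \<longrightarrow>
             Hp_opnorm lam G T \<beta> m p (partial_sum N) \<le> ereal (C * lam N))))
     \<and>
     (landau_condition lam \<and> freq_L lam < \<infinity> \<longrightarrow>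
       (\<forall>\<delta>>0. \<exists>C1. \<forall>p\<in>{1, \<infinity>}. \<forall>(G :: 'a monoid) T \<beta> m.
          lambda_dirichlet_group lam G T \<beta> \<longrightarrow> normalized_haar_measure G T m \<longrightarrow>
          (\<forall>N. Hp_opnorm lam G T \<beta> m p (partial_sum N) \<le> ereal (C1 * exp (\<delta> * lam N)))))"
proof (intro conjI impI)
  show "\<forall>p\<in>{1, \<infinity>}. \<forall>(G :: 'a monoid) T \<beta> m.
      lambda_dirichlet_group lam G T \<beta> \<longrightarrow> normalized_haar_measure G T m \<longrightarrow>
      (\<forall>N. partial_sum N \<in> Hp_dirichlet lam G T \<beta> m p \<rightarrow> Hp_dirichlet lam G T \<beta> m p)"
    by (intro ballI allI impI Pi_I) (rule partial_sum_closed[OF assms])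
next
  assume "bohr_condition lam"
  then obtain C where C: "\<And>N. 0 < lam N \<Longrightarrow>
      \<exists>d>0. d \<le> lam (Suc N) - lam N \<and> ln (1 + lam N / d) + 2 \<le> C * lam N"
    using bohr_log_bound[OF assms] by blast
  have "Hp_opnorm lam G T \<beta> m p (partial_sum N) \<le> ereal (C * lam N)"
    if prems: "p \<in> {1, \<infinity>}" "lambda_dirichlet_group lam G T \<beta>" "normalized_haar_measure G T m" "0 < lam N"
    for p and G :: "'a monoid" and T \<beta> m N
  proof -
    obtain d where "0 < d" "d \<le> lam (Suc N) - lam N" "ln (1 + lam N / d) + 2 \<le> C * lam N"
      using C[OF prems(4)] by blast
    then show ?thesis
      using Hp_opnorm_partial_sum_gap[OF assms prems(1-3)] by (meson ereal_less_eq(3) order_trans)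
  qed
  then show "\<exists>C. \<forall>p\<in>{1, \<infinity>}. \<forall>(G :: 'a monoid) T \<beta> m.
      lambda_dirichlet_group lam G T \<beta> \<longrightarrow> normalized_haar_measure G T m \<longrightarrow>
      (\<forall>N. lam N > 0 \<longrightarrow> Hp_opnorm lam G T \<beta> m p (partial_sum N) \<le> ereal (C * lam N))"
    by (intro exI[of _ C] ballI allI impI)
next
  assume L: "landau_condition lam \<and> freq_L lam < \<infinity>"
  show "\<forall>\<delta>>0. \<exists>C1. \<forall>p\<in>{1, \<infinity>}. \<forall>(G :: 'a monoid) T \<beta> m.
      lambda_dirichlet_group lam G T \<beta> \<longrightarrow> normalized_haar_measure G T m \<longrightarrow>
      (\<forall>N. Hp_opnorm lam G T \<beta> m p (partial_sum N) \<le> ereal (C1 * exp (\<delta> * lam N)))"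
  proof (intro allI impI)
    fix \<delta> :: real assume "0 < \<delta>"
    then obtain C where C: "\<And>N. \<exists>d>0. d \<le> lam (Suc N) - lam N \<and>
        ln (1 + lam N / d) + 2 \<le> C * exp (\<delta> * lam N)"
      using landau_log_bound[OF assms conjunct1[OF L]] by blast
    have "Hp_opnorm lam G T \<beta> m p (partial_sum N) \<le> ereal (C * exp (\<delta> * lam N))"
      if prems: "p \<in> {1, \<infinity>}" "lambda_dirichlet_group lam G T \<beta>" "normalized_haar_measure G T m"
      for p and G :: "'a monoid" and T \<beta> m N
    proof -
      obtain d where "0 < d" "d \<le> lam (Suc N) - lam N" "ln (1 + lam N / d) + 2 \<le> C * exp (\<delta> * lam N)"
        using C by blast
      then show ?thesis
        using Hp_opnorm_partial_sum_gap[OF assms prems] by (meson ereal_less_eq(3) order_trans)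
    qed
    then show "\<exists>C1. \<forall>p\<in>{1, \<infinity>}. \<forall>(G :: 'a monoid) T \<beta> m.
        lambda_dirichlet_group lam G T \<beta> \<longrightarrow> normalized_haar_measure G T m \<longrightarrow>
        (\<forall>N. Hp_opnorm lam G T \<beta> m p (partial_sum N) \<le> ereal (C1 * exp (\<delta> * lam N)))"
      by (intro exI[of _ C] ballI allI impI)
  qed
qed

end
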